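(* Let $G=(V,E,w)$ be a directed graph on $n$ vertices with edge weights $w:E\to\mathbb{R}_+$ and let $\pi:V\to\mathbb{R}_+$ be vertex weights. Then $$\lambda^{\triangle}_\pi(G)\lesssim \vec{\phi}_\pi(G)\lesssim \sqrt{\log n}\cdot \lambda^{\triangle}_\pi(G).$$
   Context: For $S\subseteq V$, $\delta^+(S)=\{ij\in E: i\in S, j\notin S\}$, $\delta^-(S)=\delta^+(\overline S)$, $\pi(S)=\sum_{i\in S}\pi(i)$, $w(A)=\sum_{e\in A}w(e)$. The $\pi$-weighted directed edge expansion is $\vec{\phi}_\pi(S)=\frac{\min\{w(\delta^+(S)),w(\delta^-(S))\}}{\min\{\pi(S),\pi(\overline S)\}}$ and $\vec\phi_\pi(G)=\min_{\emptyset\ne S\subsetneq V}\vec\phi_\pi(S)$. Let $\mathcal F(G)$ be the set of functions $F:E\to\mathbb{R}_{\ge0}$ with $\sum_{j:ij\in E}F(i,j)=\sum_{j:ji\in E}F(j,i)$ for all $i\in V$ and $F(e)\le w(e)$ for all $e\in E$ (with the convention $F(i,j)=0$ if $ij\notin E$). Define $$\lambda^{\triangle}_\pi(G)=\min_{v_1,\dots,v_n\in\mathbb{R}^n}\ \max_{F\in\mathcal F(G)}\ \sum_{i<j}\tfrac12\big(F(i,j)+F(j,i)\big)\|v_i-v_j\|^2$$ where the minimum is over vectors satisfying $\sum_i\pi(i)v_i=0$, $\sum_i\pi(i)\|v_i\|^2=1$, and $\|v_i-v_k\|^2+\|v_k-v_j\|^2\ge\|v_i-v_j\|^2$ for all $i,j,k\in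 V$. The notation $f\lesssim g$ means $f\le c\,g$ for an absolute constant $c>0$. *)

theory Defs
  imports Complex_Main
begin

text \<open>Vertices are 0..<n (type nat); a directed graph is an edge set
  E \<subseteq> {..<n} \<times> {..<n} with weights w and vertex weights p.
  Vectors in R^n are functions nat => real, only coordinates k < n matter.\<close>

definition vset :: "nat \<Rightarrow> nat set" where
  "vset n = {..<n}"

definition delta_out :: "(nat \<times> nat) set \<Rightarrow> nat set \<Rightarrow> (nat \<times> nat) set" where
  "delta_out E S = {(i, j) \<in> E. i \<in> S \<and> j \<notin> S}"

definition delta_in :: "nat \<Rightarrow> (nat \<times> nat) set \<Rightarrow> nat set \<Rightarrow> (nat \<times> nat) set" where
  "delta_in n E S = delta_out E (vset n - S)"

definition dir_expansion_set ::
  "nat \<Rightarrow> (nat \<times> nat) set \<Rightarrow> (nat \<times> nat \<Rightarrow> real) \<Rightarrow> (nat \<Rightarrow> real) \<Rightarrow> nat set \<Rightarrow> real" where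
  "dir_expansion_set n E w p S =
     min (sum w (delta_out E S)) (sum w (delta_in n E S)) /
     min (sum p S) (sum p (vset n - S))"

definition dir_expansion ::
  "nat \<Rightarrow> (nat \<times> nat) set \<Rightarrow> (nat \<times> nat \<Rightarrow> real) \<Rightarrow> (nat \<Rightarrow> real) \<Rightarrow> real" where
  "dir_expansion n E w p =
     Min {dir_expansion_set n E w p S | S. S \<noteq> {} \<and> S \<subset> vset n}"

definition circulations ::
  "nat \<Rightarrow> (nat \<times> nat) set \<Rightarrow> (nat \<times> nat \<Rightarrow> real) \<Rightarrow> (nat \<times> nat \<Rightarrow> real) set" where
  "circulations n E w = {F.
     (\<forall>e\<in>E. 0 \<le> F e \<and> F e \<le> w e) \<and>
     (\<forall>e. e \<notin> E \<longrightarrow> F e = 0) \<and>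
     (\<forall>i\<in>vset n. (\<Sum>j\<in>{j. (i, j) \<in> E}. F (i, j)) = (\<Sum>j\<in>{j. (j, i) \<in> E}. F (j, i)))}"

definition sqdist :: "nat \<Rightarrow> (nat \<Rightarrow> nat \<Rightarrow> real) \<Rightarrow> nat \<Rightarrow> nat \<Rightarrow> real" where
  "sqdist n v i j = (\<Sum>k<n. (v i k - v j k)\<^sup>2)"

definition sqnorm :: "nat \<Rightarrow> (nat \<Rightarrow> nat \<Rightarrow> real) \<Rightarrow> nat \<Rightarrow> real" where
  "sqnorm n v i = (\<Sum>k<n. (v i k)\<^sup>2)"

definition sdp_feasible :: "nat \<Rightarrow> (nat \<Rightarrow> real) \<Rightarrow> (nat \<Rightarrow> nat \<Rightarrow> real) \<Rightarrow> bool" where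
  "sdp_feasible n p v \<longleftrightarrow>
     (\<forall>k<n. (\<Sum>i<n. p i * v i k) = 0) \<and>
     (\<Sum>i<n. p i * sqnorm n v i) = 1 \<and>
     (\<forall>i<n. \<forall>j<n. \<forall>k<n. sqdist n v i k + sqdist n v k j \<ge> sqdist n v i j)"

definition sdp_objective ::
  "nat \<Rightarrow> (nat \<times> nat \<Rightarrow> real) \<Rightarrow> (nat \<Rightarrow> nat \<Rightarrow> real) \<Rightarrow> real" where
  "sdp_objective n F v =
     (\<Sum>(i, j)\<in>{(i, j). i < j \<and> j < n}. (1/2) * (F (i, j) + F (j, i)) * sqdist n v i j)"

text \<open>lambda^triangle_pi(G) = min over feasible v of max over circulations F
  of the objective (min and max are attained; written with Inf / Sup).\<close>

definition lambda_tri ::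
  "nat \<Rightarrow> (nat \<times> nat) set \<Rightarrow> (nat \<times> nat \<Rightarrow> real) \<Rightarrow> (nat \<Rightarrow> real) \<Rightarrow> real" where
  "lambda_tri n E w p =
     Inf {Sup {sdp_objective n F v | F. F \<in> circulations n E w} | v. sdp_feasible n p v}"

end

theory Submission
  imports Defs
begin

text \<open>Left inequality: the vector solution that takes two values according to an optimal cut.

  Right inequality: fix feasible vectors and let d be their squared distance, a metric. Suppose that
  masses a, b \<open>\<le>\<close> p of equal total and a 1-Lipschitz function f for d are given. By the definition of
  the expansion \<open>\<phi>\<close> and Gale's theorem, the graph carries a flow routing \<open>\<phi>\<close> a to \<open>\<phi>\<close> b and another one
  back; their average is a circulation whose objective is at least \<open>\<phi>\<close>/4 times the difference of the
  integrals of f against b and a. So it suffices to find a, b, f with a gap of order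
  \<open>1 / sqrt (ln n)\<close>.

  If some small ball is heavy, the distance to it works. Otherwise take f to be the distance to A, for
  two heavy sets A, B at distance at least \<open>\<Delta> = c / sqrt (ln n)\<close>. They exist by an argument
  of Arora, Rao and Vazirani in the form given by Rothvoss: otherwise, in a random direction g, there
  is on average a large fractional matching of pairs (i, j) with d i j \<open>\<le> \<Delta>\<close> and
  \<open>\<langle>g, v j - v i\<rangle> \<ge> \<sigma>\<close>. Let \<open>\<Phi> k\<close> be the mean, over i weighted by the expected matched mass and
  over g, of the maximum of \<open>\<langle>g, v j - v i\<rangle>\<close> over j with d i j \<open>\<le> k \<Delta>\<close>. These maxima have variance
  at most 2 k \<open>\<Delta>\<close>, so as long as k \<open>\<Delta>\<close> is below a constant, composing with the matching raises
  \<open>\<Phi>\<close> by a constant in each step. But \<open>\<Phi> k \<le> sqrt (2 k \<Delta> ln n)\<close>, a contradiction for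
  \<open>k \<approx> 1 / \<Delta>\<close>. Random signs in place of Gaussians keep the probability finite; the variance bound
  is then the Efron-Stein inequality.\<close>

subsection \<open>Gale's feasible flow theorem\<close>

text \<open>Flow conservation is stated weakly, against all potentials y. In the induction step the flow x on
  the new edge must lie between lower bounds from the cuts it leaves and upper bounds from the cuts
  it enters; these are compatible because the cut function is submodular.\<close>

lemma gale_flow:
  fixes w :: "'a \<times> 'a \<Rightarrow> real" and c :: "'a \<Rightarrow> real"
  assumes "finite E" "finite V" "E \<subseteq> V \<times> V" "\<And>e. e \<in> E \<Longrightarrow> 0 \<le> w e" "sum c V = 0"
    and "\<And>S. S \<subseteq> V \<Longrightarrow> sum c S \<le> (\<Sum>e\<in>E. w e * of_bool (fst e \<in> S \<and> snd e \<notin> S))"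
  shows "\<exists>F. (\<forall>e\<in>E. 0 \<le> F e \<and> F e \<le> w e) \<and> (\<forall>e. e \<notin> E \<longrightarrow> F e = 0) \<and>
           (\<forall>y::'a \<Rightarrow> real. (\<Sum>e\<in>E. F e * (y (fst e) - y (snd e))) = (\<Sum>i\<in>V. c i * y i))"
  using assms(1,3,4,5,6)
proof (induction E arbitrary: c rule: finite_induct)
  case empty
  \<comment> \<open>Cuts at single vertices give \<open>c i \<le> 0\<close>; as \<open>c\<close>
    sums to 0, it vanishes on \<open>V\<close>.\<close>
  have np: "c i \<le> 0" if "i \<in> V" for i
    using empty(4)[of "{i}"] that by simp
  have "c i = 0" if "i \<in> V" for i
    using sum_nonneg_eq_0_iff[OF \<open>finite V\<close>, of "\<lambda>i. - c i"] np empty(3) that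
    by (auto simp: sum_negf)
  then show ?case by (intro exI[of _ "\<lambda>_. 0"]) auto
next
  case (insert e E)
  obtain u v where e: "e = (u, v)" by (cases e)
  have uv: "u \<in> V" "v \<in> V" using insert.prems(1) e by auto
  define W where "W S = (\<Sum>e\<in>E. w e * of_bool (fst e \<in> S \<and> snd e \<notin> S))" for S
  have We: "(\<Sum>e\<in>insert e E. w e * of_bool (fst e \<in> S \<and> snd e \<notin> S)) =
      W S + w e * of_bool (u \<in> S \<and> v \<notin> S)" for S
    using insert.hyps e by (simp add: W_def)
  have cut: "sum c S \<le> W S + w e * of_bool (u \<in> S \<and> v \<notin> S)" if "S \<subseteq> V" for S
    using insert.prems(4)[OF that] We by simp
  have submod: "W (S \<inter> T) + W (S \<union> T) \<le> W S + W T" for S T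
    unfolding W_def sum.distrib[symmetric]
    by (intro sum_mono) (use insert.prems(2) in auto)
  \<comment> \<open>\<open>x\<close> becomes the least value meeting all lower bounds; the inserted
    0 makes it nonnegative and covers the case that no cut separates \<open>u\<close> from
    \<open>v\<close>.\<close>
  define L where "L = insert 0 ((\<lambda>S. sum c S - W S) ` {S. S \<subseteq> V \<and> u \<in> S \<and> v \<notin> S})"
  define x where "x = Max L"
  have fL: "finite L" using \<open>finite V\<close> by (simp add: L_def)
  have x0: "0 \<le> x" unfolding x_def by (rule Max_ge[OF fL]) (simp add: L_def)
  have xlow: "sum c S - W S \<le> x" if "S \<subseteq> V" "u \<in> S" "v \<notin> S" for S
    unfolding x_def by (rule Max_ge[OF fL]) (use that in \<open>auto simp: L_def\<close>)
  have xin: "x \<in> L" unfolding x_def by (rule Max_in[OF fL]) (simp add: L_def)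
  have xw: "x \<le> w e"
    using xin unfolding L_def
  proof (elim insertE imageE)
    assume "x = 0" then show ?thesis using insert.prems(2)[of e] by simp
  next
    fix S assume "x = sum c S - W S" "S \<in> {S. S \<subseteq> V \<and> u \<in> S \<and> v \<notin> S}"
    then show ?thesis using cut[of S] by simp
  qed
  have xup: "x \<le> W T - sum c T" if T: "T \<subseteq> V" "v \<in> T" "u \<notin> T" for T
    using xin unfolding L_def
  proof (elim insertE imageE)
    assume "x = 0" then show ?thesis using cut[OF T(1)] T by simp
  next
    fix S assume S: "x = sum c S - W S" "S \<in> {S. S \<subseteq> V \<and> u \<in> S \<and> v \<notin> S}"
    have fin: "finite S" "finite T" using S T \<open>finite V\<close> finite_subset by auto
    have "sum c (S \<inter> T) \<le> W (S \<inter> T)" using cut[of "S \<inter> T"] S T by auto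
    moreover have "sum c (S \<union> T) \<le> W (S \<union> T)" using cut[of "S \<union> T"] S T by auto
    moreover have "sum c (S \<union> T) + sum c (S \<inter> T) = sum c S + sum c T"
      by (rule sum.union_inter[OF fin])
    ultimately show ?thesis using submod[of S T] S by simp
  qed
  \<comment> \<open>The supply left for the edges of \<open>E\<close> once \<open>x\<close> units
    have gone from \<open>u\<close> to \<open>v\<close>.\<close>
  define c' where "c' i = c i - x * of_bool (i = u) + x * of_bool (i = v)" for i
  have c'S: "sum c' S = sum c S - x * of_bool (u \<in> S) + x * of_bool (v \<in> S)" if "S \<subseteq> V" for S
  proof -
    have "finite S" using that \<open>finite V\<close> finite_subset by auto
    then have "(\<Sum>i\<in>S. of_bool (i = a)) = (of_bool (a \<in> S) :: real)" for a
      by (simp add: of_bool_def sum.delta)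
    then show ?thesis
      by (simp add: c'_def sum.distrib sum_subtractf flip: sum_distrib_left)
  qed
  have "\<exists>F. (\<forall>e\<in>E. 0 \<le> F e \<and> F e \<le> w e) \<and> (\<forall>e. e \<notin> E \<longrightarrow> F e = 0) \<and>
      (\<forall>y::'a \<Rightarrow> real. (\<Sum>e\<in>E. F e * (y (fst e) - y (snd e))) = (\<Sum>i\<in>V. c' i * y i))"
  proof (rule insert.IH)
    show "sum c' V = 0" using c'S[of V] uv insert.prems(3) by simp
    fix S assume S: "S \<subseteq> V"
    show "sum c' S \<le> (\<Sum>e\<in>E. w e * of_bool (fst e \<in> S \<and> snd e \<notin> S))"
      unfolding W_def[symmetric] c'S[OF S]
      using cut[OF S] xlow[OF S] xup[OF S] by (cases "u \<in> S"; cases "v \<in> S") auto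
  qed (use insert.prems in auto)
  then obtain F where F: "\<And>e. e \<in> E \<Longrightarrow> 0 \<le> F e \<and> F e \<le> w e" "\<And>e. e \<notin> E \<Longrightarrow> F e = 0"
    "\<And>y::'a \<Rightarrow> real. (\<Sum>e\<in>E. F e * (y (fst e) - y (snd e))) = (\<Sum>i\<in>V. c' i * y i)"
    by blast
  have "(\<Sum>e'\<in>insert e E. (F(e := x)) e' * (y (fst e') - y (snd e'))) = (\<Sum>i\<in>V. c i * y i)"
    for y :: "'a \<Rightarrow> real"
  proof -
    have "(\<Sum>e'\<in>E. (F(e := x)) e' * (y (fst e') - y (snd e'))) =
        (\<Sum>e'\<in>E. F e' * (y (fst e') - y (snd e')))"
      using insert.hyps by (intro sum.cong) auto
    also have "\<dots> = (\<Sum>i\<in>V. c i * y i - x * (of_bool (i = u) * y i) + x * (of_bool (i = v) * y i))"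
      unfolding F(3) by (intro sum.cong) (auto simp: c'_def algebra_simps)
    also have "\<dots> = (\<Sum>i\<in>V. c i * y i) - x * y u + x * y v"
    proof -
      have "(\<Sum>i\<in>V. of_bool (i = a) * y i) = y a" if "a \<in> V" for a
        using that \<open>finite V\<close> by (subst sum.remove[of V a]) auto
      then show ?thesis
        using uv by (simp add: sum.distrib sum_subtractf flip: sum_distrib_left)
    qed
    finally show ?thesis
      using insert.hyps e by (simp del: fun_upd_apply) (simp add: algebra_simps)
  qed
  moreover have "\<forall>e'\<in>insert e E. 0 \<le> (F(e := x)) e' \<and> (F(e := x)) e' \<le> w e'"
    using F(1) x0 xw by simp
  moreover have "\<forall>e'. e' \<notin> insert e E \<longrightarrow> (F(e := x)) e' = 0"
    using F(2) by simp
  ultimately show ?case by blast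
qed

subsection \<open>Averages over random signs\<close>

text \<open>The coordinates g 0, ..., g (N - 1) are independent uniform signs; the others are 0.\<close>

fun rad_mean :: "nat \<Rightarrow> ((nat \<Rightarrow> real) \<Rightarrow> real) \<Rightarrow> real" where
  "rad_mean 0 f = f (\<lambda>_. 0)"
| "rad_mean (Suc N) f =
     (rad_mean N (\<lambda>g. f (g(N := 1))) + rad_mean N (\<lambda>g. f (g(N := -1)))) / 2"

lemma rad_mean_const [simp]: "rad_mean N (\<lambda>_. c) = c"
  by (induction N) auto

lemma rad_mean_add: "rad_mean N (\<lambda>g. f g + h g) = rad_mean N f + rad_mean N h"
  by (induction N arbitrary: f h) (auto simp: field_simps)

lemma rad_mean_cmult: "rad_mean N (\<lambda>g. c * f g) = c * rad_mean N f"
  by (induction N arbitrary: f) (auto simp: field_simps)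

lemma rad_mean_diff: "rad_mean N (\<lambda>g. f g - h g) = rad_mean N f - rad_mean N h"
  using rad_mean_add[of N f "\<lambda>g. -1 * h g"] rad_mean_cmult[of N "-1" h] by simp

lemma rad_mean_sum: "rad_mean N (\<lambda>g. \<Sum>i\<in>A. f i g) = (\<Sum>i\<in>A. rad_mean N (f i))"
  by (induction A rule: infinite_finite_induct) (auto simp: rad_mean_add)

text \<open>Only sign vectors have to be checked; the variance bound for maxima relies on each
  \<open>g k\<close> having modulus 1.\<close>

lemma rad_mean_mono:
  assumes "\<And>g. (\<And>k. k < N \<Longrightarrow> \<bar>g k\<bar> = 1) \<Longrightarrow> f g \<le> h g"
  shows "rad_mean N f \<le> rad_mean N h"
  using assms
proof (induction N arbitrary: f h)
  case (Suc N)
  have "rad_mean N (\<lambda>g. f (g(N := c))) \<le> rad_mean N (\<lambda>g. h (g(N := c)))" if "\<bar>c\<bar> = 1" for c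
    by (intro Suc.IH Suc.prems) (use that in \<open>auto simp: less_Suc_eq\<close>)
  from this[of 1] this[of "-1"] show ?case by simp
qed simp

lemma rad_mean_nonneg: "(\<And>g. 0 \<le> f g) \<Longrightarrow> 0 \<le> rad_mean N f"
  using rad_mean_mono[of N "\<lambda>_. 0" f] by simp

text \<open>Symmetry of the sign distribution. It later exchanges the two directions of a matched
  pair.\<close>

lemma rad_mean_neg: "rad_mean N (\<lambda>g. f (\<lambda>k. - g k)) = rad_mean N f"
proof (induction N arbitrary: f)
  case (Suc N)
  have eq: "(\<lambda>k. - (g(N := c)) k) = (\<lambda>k. - g k)(N := - c)" for g :: "nat \<Rightarrow> real" and c
    by auto
  show ?case
    using Suc.IH[of "\<lambda>g. f (g(N := 1))"] Suc.IH[of "\<lambda>g. f (g(N := -1))"] by (simp add: eq del: fun_upd_apply)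
qed simp

text \<open>Nonnegativity of the variance, expanded around the mean \<open>m\<close>.\<close>

lemma rad_mean_power2_le: "(rad_mean N f)\<^sup>2 \<le> rad_mean N (\<lambda>g. (f g)\<^sup>2)"
proof -
  define m where "m = rad_mean N f"
  have "0 \<le> rad_mean N (\<lambda>g. (f g - m)\<^sup>2)"
    by (simp add: rad_mean_nonneg)
  also have "(\<lambda>g. (f g - m)\<^sup>2) = (\<lambda>g. (f g)\<^sup>2 - (2 * m) * f g + m\<^sup>2)"
    by (auto simp: power2_eq_square algebra_simps)
  also have "rad_mean N \<dots> = rad_mean N (\<lambda>g. (f g)\<^sup>2) - m\<^sup>2"
    unfolding rad_mean_add rad_mean_diff rad_mean_cmult m_def[symmetric]
    by (simp add: power2_eq_square)
  finally show ?thesis by (simp add: m_def)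
qed

section \<open>The Efron-Stein inequality\<close>

abbreviation rad_var :: "nat \<Rightarrow> ((nat \<Rightarrow> real) \<Rightarrow> real) \<Rightarrow> real" where
  "rad_var N f \<equiv> rad_mean N (\<lambda>g. (f g)\<^sup>2) - (rad_mean N f)\<^sup>2"

text \<open>Induction by total variance: conditioning on the last sign leaves the mean of the
  variances of the restrictions \<open>p\<close> and \<open>q\<close> plus a quarter of the squared
  difference of their means. At opposite signs the two positive parts add up to one full square,
  which explains the factor 1/2. The one-sided form matters for maxima, where only the drop under a
  flip is controlled.\<close>

lemma efron_stein:
  "rad_var N f \<le> (\<Sum>k<N. rad_mean N (\<lambda>g. (max 0 (f g - f (g(k := - g k))))\<^sup>2)) / 2"
proof (induction N arbitrary: f)
  case (Suc N)
  define p where "p = (\<lambda>g. f (g(N := 1)))"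
  define q where "q = (\<lambda>g. f (g(N := -1)))"
  define D where "D k g = (max 0 (f g - f (g(k := - g k))))\<^sup>2" for k g
  have Dk: "rad_mean (Suc N) (D k) =
     (rad_mean N (\<lambda>g. (max 0 (p g - p (g(k := - g k))))\<^sup>2) +
      rad_mean N (\<lambda>g. (max 0 (q g - q (g(k := - g k))))\<^sup>2)) / 2" if "k < N" for k
    using that by (simp add: D_def p_def q_def fun_upd_twist)
  have DN: "rad_mean (Suc N) (D N) = rad_mean N (\<lambda>g. (p g - q g)\<^sup>2) / 2"
  proof -
    have "rad_mean (Suc N) (D N) =
        rad_mean N (\<lambda>g. (max 0 (p g - q g))\<^sup>2 + (max 0 (q g - p g))\<^sup>2) / 2"
      unfolding rad_mean_add by (simp add: D_def p_def q_def)
    also have "(\<lambda>g. (max 0 (p g - q g))\<^sup>2 + (max 0 (q g - p g))\<^sup>2) = (\<lambda>g. (p g - q g)\<^sup>2)"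
      by (auto simp: max_def power2_commute)
    finally show ?thesis .
  qed
  have "rad_var (Suc N) f = (rad_var N p + rad_var N q) / 2 + (rad_mean N p - rad_mean N q)\<^sup>2 / 4"
    by (simp add: p_def q_def power2_eq_square field_simps)
  also have "(rad_mean N p - rad_mean N q)\<^sup>2 \<le> rad_mean N (\<lambda>g. (p g - q g)\<^sup>2)"
    using rad_mean_power2_le[of N "\<lambda>g. p g - q g"] by (simp add: rad_mean_diff)
  finally have "rad_var (Suc N) f \<le>
      (rad_var N p + rad_var N q) / 2 + rad_mean N (\<lambda>g. (p g - q g)\<^sup>2) / 4"
    by simp
  also have "\<dots> \<le> ((\<Sum>k<N. rad_mean N (\<lambda>g. (max 0 (p g - p (g(k := - g k))))\<^sup>2)) / 2 +
       (\<Sum>k<N. rad_mean N (\<lambda>g. (max 0 (q g - q (g(k := - g k))))\<^sup>2)) / 2) / 2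
       + rad_mean N (\<lambda>g. (p g - q g)\<^sup>2) / 4"
    using Suc.IH[of p] Suc.IH[of q] by (simp del: fun_upd_apply)
  also have "\<dots> = (\<Sum>k<Suc N. rad_mean (Suc N) (D k)) / 2"
    using Dk DN by (simp del: rad_mean.simps add: sum.distrib add_divide_distrib sum_divide_distrib)
  finally show ?case unfolding D_def .
qed simp

section \<open>Moments and exponential moments of linear forms in random signs\<close>

definition rad_form :: "nat \<Rightarrow> (nat \<Rightarrow> real) \<Rightarrow> (nat \<Rightarrow> real) \<Rightarrow> real" where
  "rad_form N g a = (\<Sum>k<N. g k * a k)"

lemma rad_form_Suc: "rad_form (Suc N) (g(N := c)) a = rad_form N g a + c * a N"
  by (simp add: rad_form_def)

lemma rad_mean_form2: "rad_mean N (\<lambda>g. (rad_form N g a)\<^sup>2) = (\<Sum>k<N. (a k)\<^sup>2)"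
proof (induction N)
  case (Suc N)
  have "rad_mean (Suc N) (\<lambda>g. (rad_form (Suc N) g a)\<^sup>2) =
     rad_mean N (\<lambda>g. ((rad_form N g a + a N)\<^sup>2 + (rad_form N g a - a N)\<^sup>2)) / 2"
    by (simp add: rad_form_Suc rad_mean_add)
  also have "(\<lambda>g. ((rad_form N g a + a N)\<^sup>2 + (rad_form N g a - a N)\<^sup>2)) =
     (\<lambda>g. 2 * (rad_form N g a)\<^sup>2 + 2 * (a N)\<^sup>2)"
    by (auto simp: power2_eq_square algebra_simps)
  finally show ?case by (simp add: rad_mean_add rad_mean_cmult Suc)
qed (simp add: rad_form_def)

text \<open>Khintchine's inequality for the fourth moment with the Gaussian constant 3. Averaging
  over the new sign kills the odd powers, and raising the coefficient of \<open>(a N) ^ 4\<close>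
  from 1 to 3 completes the square.\<close>

lemma rad_mean_form4: "rad_mean N (\<lambda>g. (rad_form N g a) ^ 4) \<le> 3 * (\<Sum>k<N. (a k)\<^sup>2)\<^sup>2"
proof (induction N)
  case (Suc N)
  define s where "s = (\<Sum>k<N. (a k)\<^sup>2)"
  have "rad_mean (Suc N) (\<lambda>g. (rad_form (Suc N) g a) ^ 4) =
     rad_mean N (\<lambda>g. ((rad_form N g a + a N) ^ 4 + (rad_form N g a - a N) ^ 4)) / 2"
    by (simp add: rad_form_Suc rad_mean_add)
  also have "(\<lambda>g. ((rad_form N g a + a N) ^ 4 + (rad_form N g a - a N) ^ 4)) =
     (\<lambda>g. 2 * (rad_form N g a) ^ 4 + (12 * (a N)\<^sup>2) * (rad_form N g a)\<^sup>2 + 2 * (a N) ^ 4)"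
    by (auto simp: power2_eq_square power4_eq_xxxx algebra_simps)
  also have "rad_mean N \<dots> / 2 =
      rad_mean N (\<lambda>g. (rad_form N g a) ^ 4) + 6 * (a N)\<^sup>2 * s + (a N) ^ 4"
    by (simp add: rad_mean_add rad_mean_cmult rad_mean_form2 s_def)
  also have "\<dots> \<le> 3 * s\<^sup>2 + 6 * (a N)\<^sup>2 * s + 3 * (a N) ^ 4"
    using Suc zero_le_even_power[of 4 "a N", OF even_numeral] unfolding s_def[symmetric]
    by linarith
  also have "\<dots> = 3 * (s + (a N)\<^sup>2)\<^sup>2"
    by (simp add: power2_eq_square power4_eq_xxxx algebra_simps)
  finally show ?case by (simp add: s_def)
qed (simp add: rad_form_def)

text \<open>This is \<open>cosh x \<le> exp (x\<^sup>2 / 2)\<close>. After taking logarithms, the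
  difference \<open>h\<close> has derivative \<open>t - tanh t\<close>, which is nonnegative for
  \<open>t \<ge> 0\<close>; evenness covers negative \<open>x\<close>.\<close>

lemma exp_add_exp_minus_le: "exp x + exp (- x) \<le> 2 * exp (x\<^sup>2 / 2)" for x :: real
proof -
  define h :: "real \<Rightarrow> real" where "h t = t\<^sup>2 / 2 - ln (cosh t)" for t
  have pos: "0 \<le> h t" if "t \<ge> 0" for t
  proof -
    have tanh_le: "tanh u \<le> u" if "u \<ge> 0" for u :: real
    proof -
      have "0 - tanh 0 \<le> u - tanh u"
      proof (rule DERIV_nonneg_imp_nondecreasing[OF that])
        fix z :: real
        show "\<exists>y. ((\<lambda>u. u - tanh u) has_real_derivative y) (at z) \<and> 0 \<le> y"
          by (rule exI[of _ "(tanh z)\<^sup>2"]) (auto intro!: derivative_eq_intros)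
      qed
      then show ?thesis by simp
    qed
    have "h 0 \<le> h t"
    proof (rule DERIV_nonneg_imp_nondecreasing[OF that])
      fix u :: real assume "0 \<le> u"
      then show "\<exists>y. (h has_real_derivative y) (at u) \<and> 0 \<le> y"
        unfolding h_def using tanh_le[of u]
        by (intro exI[of _ "u - tanh u"]) (auto intro!: derivative_eq_intros simp: tanh_def)
    qed
    then show ?thesis by (simp add: h_def)
  qed
  have "ln (cosh x) \<le> x\<^sup>2 / 2" using pos[of "\<bar>x\<bar>"] by (simp add: h_def)
  then have "cosh x \<le> exp (x\<^sup>2 / 2)" by (metis cosh_real_pos exp_ln exp_le_cancel_iff)
  then show ?thesis by (simp add: cosh_field_def)
qed

text \<open>Subgaussian bound: independence gives one factor \<open>cosh (a k)\<close> per
  sign.\<close>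

lemma rad_mean_exp: "rad_mean N (\<lambda>g. exp (rad_form N g a)) \<le> exp ((\<Sum>k<N. (a k)\<^sup>2) / 2)"
proof (induction N)
  case (Suc N)
  have "rad_mean (Suc N) (\<lambda>g. exp (rad_form (Suc N) g a)) =
     rad_mean N (\<lambda>g. exp (rad_form N g a + a N) + exp (rad_form N g a - a N)) / 2"
    by (simp add: rad_form_Suc rad_mean_add)
  also have "(\<lambda>g. exp (rad_form N g a + a N) + exp (rad_form N g a - a N)) =
     (\<lambda>g. (exp (a N) + exp (- a N)) * exp (rad_form N g a))"
    by (auto simp: exp_add exp_diff exp_minus divide_inverse algebra_simps)
  also have "rad_mean N \<dots> / 2 = (exp (a N) + exp (- a N)) * rad_mean N (\<lambda>g. exp (rad_form N g a)) / 2"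
    by (simp add: rad_mean_cmult)
  also have "\<dots> \<le> (2 * exp ((a N)\<^sup>2 / 2)) * exp ((\<Sum>k<N. (a k)\<^sup>2) / 2) / 2"
    by (intro divide_right_mono mult_mono exp_add_exp_minus_le Suc)
       (auto intro: rad_mean_nonneg)
  finally show ?case by (simp add: exp_add add_divide_distrib mult.commute del: rad_mean.simps)
qed (simp add: rad_form_def)

text \<open>A random projection of a vector is comparable to its length with constant probability. A
  parabola in the normalised square \<open>z\<close> lies below the indicator of
  \<open>z \<ge> 1/2\<close>; the second and fourth moments bound its mean from below by 2/5 - 1/5 -
  3/30 = 1/10.\<close>

lemma rad_mean_paley_zygmund:
  "rad_mean N (\<lambda>g. of_bool ((rad_form N g a)\<^sup>2 \<ge> (\<Sum>k<N. (a k)\<^sup>2) / 2)) \<ge> 1 / 10"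
proof (cases "(\<Sum>k<N. (a k)\<^sup>2) = 0")
  case True
  then show ?thesis by simp
next
  case False
  define s where "s = (\<Sum>k<N. (a k)\<^sup>2)"
  have s: "s > 0" using False sum_nonneg[of "{..<N}" "\<lambda>k. (a k)\<^sup>2"] by (simp add: s_def less_le)
  \<comment> \<open>The parabola attains its maximum 1 at z = 6; its mean is then computed from moments 2 and 4.\<close>
  have pw: "(2/5) * (z - 1/2) - (1/30) * z\<^sup>2 \<le> of_bool (z \<ge> 1/2)" if "z \<ge> 0" for z :: real
  proof -
    have "0 \<le> (z - 6)\<^sup>2" by simp
    then have "0 \<le> z\<^sup>2 - 12 * z + 36" by (simp add: power2_eq_square algebra_simps)
    then show ?thesis using zero_le_power2[of z]
      unfolding of_bool_def by (split if_split) (intro conjI impI; argo)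
  qed
  have "(1::real) / 10 = (2/5) / s * s - 1/5 - (1/30) / s\<^sup>2 * (3 * s\<^sup>2)" using s by simp
  also have "\<dots> \<le> (2/5) / s * rad_mean N (\<lambda>g. (rad_form N g a)\<^sup>2) - 1/5 -
      (1/30) / s\<^sup>2 * rad_mean N (\<lambda>g. (rad_form N g a) ^ 4)"
    using rad_mean_form4[of N a] s unfolding rad_mean_form2 s_def[symmetric]
    by (intro diff_mono mult_left_mono) auto
  also have "\<dots> = rad_mean N (\<lambda>g. (2/5) / s * (rad_form N g a)\<^sup>2 - 1/5 -
      (1/30) / s\<^sup>2 * (rad_form N g a) ^ 4)"
    by (simp only: rad_mean_diff rad_mean_cmult rad_mean_const)
  also have "\<dots> \<le> rad_mean N (\<lambda>g. of_bool ((rad_form N g a)\<^sup>2 \<ge> s / 2))"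
  proof (rule rad_mean_mono)
    fix g
    have "(2/5) / s * (rad_form N g a)\<^sup>2 - 1/5 - (1/30) / s\<^sup>2 * (rad_form N g a) ^ 4 =
      (2/5) * ((rad_form N g a)\<^sup>2 / s - 1/2) - (1/30) * ((rad_form N g a)\<^sup>2 / s)\<^sup>2"
      by (simp add: power_divide field_simps flip: power_mult)
    also have "\<dots> \<le> of_bool ((rad_form N g a)\<^sup>2 / s \<ge> 1/2)"
      using s by (intro pw) auto
    finally show "(2/5) / s * (rad_form N g a)\<^sup>2 - 1/5 - (1/30) / s\<^sup>2 * (rad_form N g a) ^ 4
       \<le> of_bool ((rad_form N g a)\<^sup>2 \<ge> s / 2)"
      using s by (simp add: field_simps)
  qed
  finally show ?thesis by (simp add: s_def)
qed

lemma rad_form_cmult: "rad_form N g (\<lambda>k. t * a k) = t * rad_form N g a"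
  by (simp add: rad_form_def sum_distrib_left algebra_simps)

lemma rad_form_diff: "rad_form N g (\<lambda>k. a k - b k) = rad_form N g a - rad_form N g b"
  by (simp add: rad_form_def algebra_simps sum_subtractf)

lemma rad_form_neg: "rad_form N (\<lambda>k. - g k) a = - rad_form N g a"
  by (simp add: rad_form_def sum_negf)

lemma rad_form_flip:
  assumes "k < N"
  shows "rad_form N (g(k := - g k)) a = rad_form N g a - 2 * g k * a k"
proof -
  have "rad_form N (g(k := - g k)) a = - g k * a k + (\<Sum>l\<in>{..<N} - {k}. g l * a l)"
    unfolding rad_form_def using assms by (subst sum.remove[of _ k]) auto
  moreover have "rad_form N g a = g k * a k + (\<Sum>l\<in>{..<N} - {k}. g l * a l)"
    unfolding rad_form_def using assms by (subst sum.remove[of _ k]) auto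
  ultimately show ?thesis by simp
qed

section \<open>Maxima of linear forms: variance and mean\<close>

context
  fixes J :: "'b set" and u :: "'b \<Rightarrow> nat \<Rightarrow> real" and N :: nat and R :: real
    and Y :: "(nat \<Rightarrow> real) \<Rightarrow> real"
  assumes J: "finite J" "J \<noteq> {}"
    and norm_le: "\<And>j. j \<in> J \<Longrightarrow> (\<Sum>k<N. (u j k)\<^sup>2) \<le> R"
    and Y: "\<And>g. Y g = Max ((\<lambda>j. rad_form N g (u j)) ` J)"
begin

lemma max_form_ge: "j \<in> J \<Longrightarrow> rad_form N g (u j) \<le> Y g"
  unfolding Y using J by auto

lemma max_form_attained: "\<exists>j\<in>J. Y g = rad_form N g (u j)"
proof -
  have "Y g \<in> (\<lambda>j. rad_form N g (u j)) ` J" unfolding Y by (rule Max_in) (use J in auto)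
  then show ?thesis by auto
qed

text \<open>If \<open>j\<close> attains the maximum at \<open>g\<close>, it still competes after
  sign \<open>k\<close> is flipped, so the maximum drops by at most twice the modulus of
  \<open>u j k\<close>. The squared drops sum to at most \<open>4 * R\<close>, whatever the number
  of vectors, and Efron-Stein halves this.\<close>

lemma rad_var_max_le: "rad_var N Y \<le> 2 * R"
proof -
  have "(\<Sum>k<N. rad_mean N (\<lambda>g. (max 0 (Y g - Y (g(k := - g k))))\<^sup>2)) \<le> rad_mean N (\<lambda>_. 4 * R)"
    unfolding rad_mean_sum[symmetric]
  proof (rule rad_mean_mono)
    fix g :: "nat \<Rightarrow> real" assume g: "\<And>k. k < N \<Longrightarrow> \<bar>g k\<bar> = 1"
    obtain j where j: "j \<in> J" "Y g = rad_form N g (u j)" using max_form_attained by blast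
    have "(max 0 (Y g - Y (g(k := - g k))))\<^sup>2 \<le> 4 * (u j k)\<^sup>2" if "k < N" for k
    proof -
      have "Y g - Y (g(k := - g k)) \<le> 2 * g k * u j k"
        using max_form_ge[OF j(1), of "g(k := - g k)"] j(2) rad_form_flip[OF that, of g "u j"]
        by simp
      also have "\<dots> \<le> 2 * \<bar>u j k\<bar>"
        using abs_ge_self[of "g k * u j k"] g[OF that] by (simp add: abs_mult)
      finally have "(max 0 (Y g - Y (g(k := - g k))))\<^sup>2 \<le> (2 * \<bar>u j k\<bar>)\<^sup>2"
        by (intro power_mono) auto
      then show ?thesis by (simp add: power_mult_distrib)
    qed
    then have "(\<Sum>k<N. (max 0 (Y g - Y (g(k := - g k))))\<^sup>2) \<le> (\<Sum>k<N. 4 * (u j k)\<^sup>2)"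
      by (intro sum_mono) auto
    also have "\<dots> \<le> 4 * R" using norm_le[OF j(1)] by (simp flip: sum_distrib_left)
    finally show "(\<Sum>k<N. (max 0 (Y g - Y (g(k := - g k))))\<^sup>2) \<le> 4 * R" .
  qed
  then show ?thesis using efron_stein[of N Y] by simp
qed

text \<open>The mean absolute deviation is at most the standard deviation.\<close>

lemma rad_mean_max_deviation_le:
  assumes "2 * R \<le> r\<^sup>2" "0 \<le> r"
  shows "rad_mean N (\<lambda>g. \<bar>Y g - rad_mean N Y\<bar>) \<le> r"
proof -
  define m where "m = rad_mean N Y"
  have "(rad_mean N (\<lambda>g. \<bar>Y g - m\<bar>))\<^sup>2 \<le> rad_mean N (\<lambda>g. (Y g - m)\<^sup>2)"
    using rad_mean_power2_le[of N "\<lambda>g. \<bar>Y g - m\<bar>"] by simp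
  also have "(\<lambda>g. (Y g - m)\<^sup>2) = (\<lambda>g. (Y g)\<^sup>2 - (2 * m) * Y g + m\<^sup>2)"
    by (auto simp: power2_eq_square algebra_simps)
  also have "rad_mean N \<dots> = rad_var N Y"
    unfolding rad_mean_add rad_mean_diff rad_mean_cmult m_def[symmetric]
    by (simp add: power2_eq_square)
  also have "\<dots> \<le> r\<^sup>2" using rad_var_max_le assms(1) by linarith
  finally show ?thesis using assms(2) by (simp add: m_def power2_le_iff_abs_le)
qed

text \<open>The exponential of the maximum is at most the sum of all exponentials, whose means are
  subgaussian. The parameter \<open>t\<close> stays free so that it can be matched to the radius
  later.\<close>

lemma rad_mean_max_le:
  shows "t * rad_mean N Y \<le> ln (real (card J)) + t\<^sup>2 * R / 2"
proof -
  define m where "m = rad_mean N Y"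
  \<comment> \<open>Jensen's inequality by hand: the tangent to \<open>exp\<close> at
    \<open>t * m\<close> has mean exactly \<open>exp (t * m)\<close>.\<close>
  have "exp (t * m) = rad_mean N (\<lambda>g. exp (t * m) * (1 - t * m) + (exp (t * m) * t) * Y g)"
    unfolding rad_mean_add rad_mean_cmult m_def[symmetric] by (simp add: algebra_simps)
  also have "\<dots> \<le> rad_mean N (\<lambda>g. \<Sum>j\<in>J. exp (rad_form N g (\<lambda>k. t * u j k)))"
  proof (rule rad_mean_mono)
    fix g
    obtain j where j: "j \<in> J" "Y g = rad_form N g (u j)" using max_form_attained by blast
    have "exp (t * m) * (1 - t * m) + (exp (t * m) * t) * Y g = exp (t * m) * (1 + (t * Y g - t * m))"
      by (simp add: algebra_simps)
    also have "\<dots> \<le> exp (t * m) * exp (t * Y g - t * m)"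
      by (intro mult_left_mono exp_ge_add_one_self) auto
    also have "\<dots> = exp (rad_form N g (\<lambda>k. t * u j k))"
      by (simp add: rad_form_cmult j flip: exp_add)
    also have "\<dots> \<le> (\<Sum>j\<in>J. exp (rad_form N g (\<lambda>k. t * u j k)))"
      using J j by (intro member_le_sum) auto
    finally show "exp (t * m) * (1 - t * m) + (exp (t * m) * t) * Y g \<le> \<dots>" .
  qed
  also have "\<dots> = (\<Sum>j\<in>J. rad_mean N (\<lambda>g. exp (rad_form N g (\<lambda>k. t * u j k))))"
    by (rule rad_mean_sum)
  also have "\<dots> \<le> (\<Sum>j\<in>J. exp (t\<^sup>2 * R / 2))"
  proof (rule sum_mono)
    fix j assume "j \<in> J"
    have "rad_mean N (\<lambda>g. exp (rad_form N g (\<lambda>k. t * u j k))) \<le> exp ((\<Sum>k<N. (t * u j k)\<^sup>2) / 2)"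
      by (rule rad_mean_exp)
    also have "(\<Sum>k<N. (t * u j k)\<^sup>2) = t\<^sup>2 * (\<Sum>k<N. (u j k)\<^sup>2)"
      by (simp add: power_mult_distrib sum_distrib_left)
    also have "exp (t\<^sup>2 * (\<Sum>k<N. (u j k)\<^sup>2) / 2) \<le> exp (t\<^sup>2 * R / 2)"
      using norm_le[OF \<open>j \<in> J\<close>] by (simp add: mult_left_mono)
    finally show "rad_mean N (\<lambda>g. exp (rad_form N g (\<lambda>k. t * u j k))) \<le> exp (t\<^sup>2 * R / 2)" .
  qed
  also have "\<dots> = exp (ln (real (card J)) + t\<^sup>2 * R / 2)"
    using J by (simp add: exp_add card_gt_0_iff)
  finally show ?thesis by (simp add: m_def)
qed

end

subsection \<open>Greedy fractional matchings\<close>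

text \<open>Allowed pairs are served one after another, each with as much mass as its ends still
  permit. Every allowed pair thus ends with a saturated end, so no allowed pair joins two
  unsaturated vertices.\<close>

lemma greedy_matching:
  fixes \<alpha> \<beta> :: "'a \<Rightarrow> real"
  assumes "finite P" "finite V" "P \<subseteq> V \<times> V" "\<And>i. 0 \<le> \<alpha> i" "\<And>i. 0 \<le> \<beta> i"
  shows "\<exists>m. (\<forall>i j. 0 \<le> m i j) \<and> (\<forall>i j. (i, j) \<notin> P \<longrightarrow> m i j = 0) \<and>
     (\<forall>i. (\<Sum>j\<in>V. m i j) \<le> \<alpha> i) \<and> (\<forall>j. (\<Sum>i\<in>V. m i j) \<le> \<beta> j) \<and>
     (\<forall>(i, j)\<in>P. (\<Sum>j\<in>V. m i j) = \<alpha> i \<or> (\<Sum>i\<in>V. m i j) = \<beta> j)"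
  using assms(1,3,4,5)
proof (induction P arbitrary: \<alpha> \<beta> rule: finite_induct)
  case empty
  then show ?case by (intro exI[of _ "\<lambda>_ _. 0"]) auto
next
  case (insert e P)
  obtain a b where e: "e = (a, b)" by (cases e)
  have ab: "a \<in> V" "b \<in> V" using insert.prems e by auto
  \<comment> \<open>\<open>x\<close> exhausts one end of \<open>e\<close>, so the remaining pairs
    can add nothing at that end.\<close>
  define x where "x = min (\<alpha> a) (\<beta> b)"
  have x0: "0 \<le> x" using insert.prems by (simp add: x_def)
  define \<alpha>' where "\<alpha>' i = \<alpha> i - x * of_bool (i = a)" for i
  define \<beta>' where "\<beta>' j = \<beta> j - x * of_bool (j = b)" for j
  have nn: "0 \<le> \<alpha>' i" "0 \<le> \<beta>' i" for i
    using insert.prems by (auto simp: \<alpha>'_def \<beta>'_def x_def)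
  obtain m where m: "\<And>i j. 0 \<le> m i j" "\<And>i j. (i, j) \<notin> P \<Longrightarrow> m i j = 0"
    "\<And>i. (\<Sum>j\<in>V. m i j) \<le> \<alpha>' i" "\<And>j. (\<Sum>i\<in>V. m i j) \<le> \<beta>' j"
    "\<And>i j. (i, j) \<in> P \<Longrightarrow> (\<Sum>j\<in>V. m i j) = \<alpha>' i \<or> (\<Sum>i\<in>V. m i j) = \<beta>' j"
  proof -
    have "P \<subseteq> V \<times> V" using insert.prems(1) by auto
    from insert.IH[of \<alpha>' \<beta>', OF this nn] obtain m where
      "\<forall>i j. 0 \<le> m i j" "\<forall>i j. (i, j) \<notin> P \<longrightarrow> m i j = 0"
      "\<forall>i. (\<Sum>j\<in>V. m i j) \<le> \<alpha>' i" "\<forall>j. (\<Sum>i\<in>V. m i j) \<le> \<beta>' j"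
      "\<forall>(i, j)\<in>P. (\<Sum>j\<in>V. m i j) = \<alpha>' i \<or> (\<Sum>i\<in>V. m i j) = \<beta>' j"
      by (elim exE conjE)
    then show ?thesis by (intro that[of m]) auto
  qed
  define m' where "m' i j = m i j + x * (of_bool (i = a) * of_bool (j = b))" for i j
  have delta: "(\<Sum>i\<in>V. of_bool (i = c)) = (1::real)" if "c \<in> V" for c
    using that \<open>finite V\<close> by (subst sum.remove[of V c]) auto
  have row: "(\<Sum>j\<in>V. m' i j) = (\<Sum>j\<in>V. m i j) + x * of_bool (i = a)" for i
    using delta[OF ab(2)] by (simp add: m'_def sum.distrib flip: sum_distrib_left)
  have col: "(\<Sum>i\<in>V. m' i j) = (\<Sum>i\<in>V. m i j) + x * of_bool (j = b)" for j
    using delta[OF ab(1)]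
    by (simp add: m'_def sum.distrib flip: sum_distrib_left sum_distrib_right)
  have row0: "(\<Sum>j\<in>V. m i j) \<ge> 0" and col0: "(\<Sum>i\<in>V. m i j) \<ge> 0" for i j
    using m(1) by (auto intro: sum_nonneg)
  have "(\<Sum>j\<in>V. m' i j) = \<alpha> i \<or> (\<Sum>i\<in>V. m' i j) = \<beta> j" if "(i, j) \<in> insert e P" for i j
  proof (cases "(i, j) = e")
    case True
    then have "i = a" "j = b" using e by auto
    then show ?thesis
      using m(3)[of a] m(4)[of b] row0[of a] col0[of b] unfolding row col
      by (auto simp: \<alpha>'_def \<beta>'_def x_def min_def split: if_splits)
  next
    case False
    then have "(i, j) \<in> P" using that by auto
    from m(5)[OF this] show ?thesis unfolding row col by (auto simp: \<alpha>'_def \<beta>'_def)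
  qed
  moreover have "(\<Sum>j\<in>V. m' i j) \<le> \<alpha> i" "(\<Sum>j\<in>V. m' j i) \<le> \<beta> i" for i
    using m(3)[of i] m(4)[of i] unfolding row col by (auto simp: \<alpha>'_def \<beta>'_def)
  moreover have "0 \<le> m' i j" "(i, j) \<notin> insert e P \<longrightarrow> m' i j = 0" for i j
    using m(1)[of i j] m(2)[of i j] x0 e by (auto simp: m'_def)
  ultimately show ?case by (intro exI[of _ m']) blast
qed

section \<open>Cutting the line at a weighted median\<close>

text \<open>\<open>m\<close> is the least attained value with at least half of the mass at or below
  it.\<close>

lemma weighted_median:
  fixes x p :: "'a \<Rightarrow> real"
  assumes "finite V" "\<And>i. i \<in> V \<Longrightarrow> 0 \<le> p i" "sum p V = 1"
  obtains m where "sum p {i\<in>V. x i \<le> m} \<ge> 1/2" "sum p {i\<in>V. x i \<ge> m} \<ge> 1/2"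
proof -
  define T where "T = {t \<in> x ` V. sum p {i\<in>V. x i \<le> t} \<ge> 1/2}"
  have "V \<noteq> {}" using assms(3) by auto
  then have "Max (x ` V) \<in> x ` V" using assms(1) by (intro Max_in) auto
  moreover have "{i\<in>V. x i \<le> Max (x ` V)} = V" using assms(1) by auto
  ultimately have "Max (x ` V) \<in> T" using assms(3) by (simp add: T_def)
  moreover have "finite T" using assms(1) by (simp add: T_def)
  ultimately have T: "finite T" "T \<noteq> {}" by auto
  define m where "m = Min T"
  have mT: "m \<in> T" unfolding m_def using T by (rule Min_in)
  have "sum p {i\<in>V. x i < m} \<le> 1/2"
  proof (cases "{i\<in>V. x i < m} = {}")
    case True
    then show ?thesis by (simp only: sum.empty)
  next
    case False
    \<comment> \<open>The attained value just before \<open>m\<close>: the mass strictly below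
      \<open>m\<close> is the mass up to \<open>y\<close>, and \<open>y\<close> misses the threshold
      by minimality of \<open>m\<close>.\<close>
    define y where "y = Max (x ` {i\<in>V. x i < m})"
    have y: "y \<in> x ` {i\<in>V. x i < m}"
      unfolding y_def using False assms(1) by (intro Max_in) auto
    have "y < m" using y by auto
    then have "y \<notin> T" using Min_le[OF T(1), of y] unfolding m_def by (meson leD)
    moreover have "{i\<in>V. x i < m} = {i\<in>V. x i \<le> y}"
    proof -
      have "x i \<le> y" if "i \<in> V" "x i < m" for i
        unfolding y_def using that assms(1) by (intro Max_ge) auto
      then show ?thesis using y by auto
    qed
    ultimately show ?thesis using y by (force simp: T_def)
  qed
  moreover have "sum p V = sum p {i\<in>V. x i < m} + sum p {i\<in>V. x i \<ge> m}"
    using assms(1) by (subst sum.union_disjoint[symmetric]) (auto intro!: sum.cong)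
  ultimately show ?thesis using mT assms(3) that by (auto simp: T_def)
qed

text \<open>Two points at distance \<open>2 * \<sigma>\<close> or more cannot both lie strictly
  within \<open>\<sigma>\<close> of the median. Hence the tails \<open>H\<close> and
  \<open>L\<close> together carry at least \<open>q / 2\<close>. A tail of mass at least
  \<open>q / 4\<close> is paired with the half of the mass across the median, which suffices because
  \<open>q \<le> 1\<close>.\<close>

lemma spread_halves:
  fixes x p :: "'a \<Rightarrow> real"
  assumes V: "finite V" and p: "\<And>i. i \<in> V \<Longrightarrow> 0 \<le> p i" "sum p V = 1" and "0 < \<sigma>"
    and q: "q = (\<Sum>i\<in>V. \<Sum>j\<in>V. p i * p j * of_bool (\<bar>x i - x j\<bar> \<ge> 2 * \<sigma>))"
  shows "\<exists>A B. A \<subseteq> V \<and> B \<subseteq> V \<and> q / 4 \<le> sum p A \<and> q / 4 \<le> sum p B \<and>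
    (\<forall>i\<in>B. \<forall>j\<in>A. \<sigma> \<le> x j - x i)"
proof -
  obtain m where m: "sum p {i\<in>V. x i \<le> m} \<ge> 1/2" "sum p {i\<in>V. x i \<ge> m} \<ge> 1/2"
    using weighted_median[of V p x] V p by blast
  define H where "H = {i\<in>V. x i \<ge> m + \<sigma>}"
  define L where "L = {i\<in>V. x i \<le> m - \<sigma>}"
  have sub: "H \<subseteq> V" "L \<subseteq> V" by (auto simp: H_def L_def)
  have sumI: "(\<Sum>i\<in>V. p i * of_bool (i \<in> S)) = sum p S" if "S \<subseteq> V" for S
    using that V by (auto simp: of_bool_def if_distrib sum.If_cases Int_absorb1 cong: if_cong)
  have "q \<le> (\<Sum>i\<in>V. \<Sum>j\<in>V. p i * p j * (of_bool (i \<in> H) + of_bool (i \<in> L) +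
      of_bool (j \<in> H) + of_bool (j \<in> L)))"
    unfolding q
    by (intro sum_mono mult_left_mono) (use p in \<open>auto simp: H_def L_def\<close>)
  also have "\<dots> = (\<Sum>i\<in>V. \<Sum>j\<in>V. p j * (p i * of_bool (i \<in> H)) + p j * (p i * of_bool (i \<in> L)) +
      p i * (p j * of_bool (j \<in> H)) + p i * (p j * of_bool (j \<in> L)))"
    by (intro sum.cong) (auto simp: algebra_simps)
  also have "\<dots> = 2 * (sum p H + sum p L)"
    using p(2)
    by (simp add: sum.distrib sumI sub flip: sum_distrib_left sum_distrib_right)
  finally have qle: "q \<le> 2 * (sum p H + sum p L)" .
  have "q \<le> 1"
  proof -
    have "q \<le> (\<Sum>i\<in>V. \<Sum>j\<in>V. p i * p j * 1)"
      unfolding q by (intro sum_mono mult_left_mono) (use p in auto)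
    also have "\<dots> = 1" using p(2) by (simp flip: sum_distrib_left)
    finally show ?thesis .
  qed
  show ?thesis
  proof (cases "q / 4 \<le> sum p H")
    case True
    then show ?thesis using m(1) \<open>q \<le> 1\<close>
      by (intro exI[of _ H] exI[of _ "{i\<in>V. x i \<le> m}"]) (auto simp: H_def)
  next
    case False
    then have "sum p H < q / 4" by simp
    then have "q / 4 \<le> sum p L" using qle by (simp add: field_simps)
    then show ?thesis using m(2) \<open>q \<le> 1\<close>
      by (intro exI[of _ "{i\<in>V. x i \<ge> m}"] exI[of _ L]) (auto simp: L_def)
  qed
qed

subsection \<open>Chaining matchings\<close>

text \<open>A finite space of negative type: the squared Euclidean distances themselves satisfy the
  triangle inequality. The weights are normalised to a probability.\<close>

locale l22_space =
  fixes V :: "'a set" and N :: nat and v :: "'a \<Rightarrow> nat \<Rightarrow> real" and p :: "'a \<Rightarrow> real"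
    and d :: "'a \<Rightarrow> 'a \<Rightarrow> real"
  assumes d_def: "\<And>i j. d i j = (\<Sum>k<N. (v i k - v j k)\<^sup>2)"
    and V: "finite V"
    and triangle: "\<And>i j k. i \<in> V \<Longrightarrow> j \<in> V \<Longrightarrow> k \<in> V \<Longrightarrow> d i j \<le> d i k + d k j"
    and p: "\<And>i. i \<in> V \<Longrightarrow> 0 \<le> p i" and p_sum: "sum p V = 1"
begin

lemma d_nonneg: "0 \<le> d i j" by (simp add: d_def sum_nonneg)
lemma d_self [simp]: "d i i = 0" by (simp add: d_def)
lemma d_commute: "d i j = d j i" by (simp add: d_def power2_commute)

definition step :: "(nat \<Rightarrow> real) \<Rightarrow> 'a \<Rightarrow> 'a \<Rightarrow> real" where
  "step g i j = rad_form N g (\<lambda>k. v j k - v i k)"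

lemma step_self [simp]: "step g i i = 0"
  by (simp add: step_def rad_form_def)

lemma step_add: "step g i j + step g j l = step g i l"
  by (simp add: step_def rad_form_diff)

lemma step_neg: "step (\<lambda>k. - g k) i j = step g j i"
  by (simp add: step_def rad_form_diff rad_form_neg)

text \<open>Metric balls replace the sets reachable by k matching steps: by the triangle inequality, a matched
  pair maps the ball of radius r about one end into that of radius \<open>r + \<Delta>\<close> about the other.\<close>

definition near :: "real \<Rightarrow> 'a \<Rightarrow> 'a set" where
  "near r i = {j\<in>V. d i j \<le> r}"

definition climb :: "real \<Rightarrow> 'a \<Rightarrow> (nat \<Rightarrow> real) \<Rightarrow> real" where
  "climb r i g = Max ((\<lambda>j. step g i j) ` near r i)"

lemma near: "finite (near r i)" "0 \<le> r \<Longrightarrow> i \<in> V \<Longrightarrow> near r i \<noteq> {}"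
  "j \<in> near r i \<Longrightarrow> (\<Sum>k<N. (v j k - v i k)\<^sup>2) \<le> r"
  using V by (auto simp: near_def d_def power2_commute)

lemma climb_ge: "j \<in> near r i \<Longrightarrow> step g i j \<le> climb r i g"
  unfolding climb_def using near(1) by (intro Max_ge) auto

lemma climb_deviation:
  assumes "i \<in> V" "0 \<le> r" "2 * r \<le> s\<^sup>2" "0 \<le> s"
  shows "rad_mean N (\<lambda>g. \<bar>climb r i g - rad_mean N (climb r i)\<bar>) \<le> s"
  using rad_mean_max_deviation_le[OF near(1) near(2)[OF assms(2,1)] near(3) _ assms(3,4)]
  by (simp add: climb_def step_def)

lemma climb_mean_le:
  assumes "i \<in> V" "0 \<le> r"
  shows "t * rad_mean N (climb r i) \<le> ln (real (card V)) + t\<^sup>2 * r / 2"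
proof -
  have "t * rad_mean N (climb r i) \<le> ln (real (card (near r i))) + t\<^sup>2 * r / 2"
    using rad_mean_max_le[OF near(1) near(2)[OF assms(2,1)] near(3)]
    by (simp add: climb_def step_def)
  moreover have "card (near r i) \<le> card V" "card (near r i) > 0"
    using V near(1,2) assms by (auto intro!: card_mono simp: near_def card_gt_0_iff)
  ultimately show ?thesis by (simp add: ln_mono order_trans)
qed

text \<open>A best target \<open>l\<close> for \<open>j\<close> within radius \<open>r\<close> lies
  within \<open>r + \<Delta>\<close> of \<open>i\<close>, and projections add along the path from
  \<open>i\<close> through \<open>j\<close> to \<open>l\<close>.\<close>

lemma climb_step:
  assumes "i \<in> V" "j \<in> V" "d i j \<le> \<Delta>" "\<sigma> \<le> step g i j" "0 \<le> r"
  shows "\<sigma> + climb r j g \<le> climb (r + \<Delta>) i g"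
proof -
  have "climb r j g \<in> (\<lambda>l. step g j l) ` near r j"
    unfolding climb_def using near(1,2) assms by (intro Max_in) auto
  then obtain l where l: "l \<in> near r j" "climb r j g = step g j l" by auto
  have "l \<in> near (r + \<Delta>) i" using l(1) triangle[of i l j] assms by (auto simp: near_def)
  from climb_ge[OF this, of g] show ?thesis using l(2) assms(4) step_add[of g i j l] by simp
qed

section \<open>Growth of the expected climb under matchings\<close>

text \<open>Fractional and directed: mass moves from \<open>i\<close> up to \<open>j\<close>. A
  vertex may give away \<open>p i\<close> and, independently, receive \<open>p i\<close>.\<close>

definition matching :: "real \<Rightarrow> real \<Rightarrow> (nat \<Rightarrow> real) \<Rightarrow> ('a \<Rightarrow> 'a \<Rightarrow> real) \<Rightarrow> bool" where
  "matching \<Delta> \<sigma> g m \<longleftrightarrow> (\<forall>i\<in>V. \<forall>j\<in>V. 0 \<le> m i j) \<and>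
     (\<forall>i\<in>V. \<forall>j\<in>V. m i j \<noteq> 0 \<longrightarrow> d i j \<le> \<Delta> \<and> \<sigma> \<le> step g i j) \<and>
     (\<forall>i\<in>V. (\<Sum>j\<in>V. m i j) \<le> p i) \<and> (\<forall>j\<in>V. (\<Sum>i\<in>V. m i j) \<le> p j)"

text \<open>\<open>climb_step\<close> summed with weights \<open>m\<close>. The random climbs are
  then replaced by reference values \<open>a\<close> and \<open>b\<close>, later their means; as the
  matched mass at a vertex is at most \<open>p\<close>, this costs only the
  \<open>p\<close>-weighted deviations.\<close>

lemma climb_growth_pointwise:
  assumes m: "matching \<Delta> \<sigma> g m" and "0 \<le> r"
  shows "\<sigma> * (\<Sum>i\<in>V. \<Sum>j\<in>V. m i j) + (\<Sum>j\<in>V. (\<Sum>i\<in>V. m i j) * b j) \<le>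
    (\<Sum>i\<in>V. (\<Sum>j\<in>V. m i j) * a i) + (\<Sum>i\<in>V. p i * \<bar>climb (r + \<Delta>) i g - a i\<bar>)
     + (\<Sum>i\<in>V. p i * \<bar>climb r i g - b i\<bar>)"
proof -
  have nn: "0 \<le> m i j" if "i \<in> V" "j \<in> V" for i j
    using m that by (auto simp: matching_def)
  have "(\<Sum>i\<in>V. \<Sum>j\<in>V. m i j * (\<sigma> + climb r j g)) \<le> (\<Sum>i\<in>V. \<Sum>j\<in>V. m i j * climb (r + \<Delta>) i g)"
  proof (intro sum_mono)
    fix i j assume ij: "i \<in> V" "j \<in> V"
    show "m i j * (\<sigma> + climb r j g) \<le> m i j * climb (r + \<Delta>) i g"
    proof (cases "m i j = 0")
      case False
      then show ?thesis
        using m ij nn[OF ij] climb_step[OF ij _ _ \<open>0 \<le> r\<close>]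
        by (intro mult_left_mono) (auto simp: matching_def)
    qed simp
  qed
  also have "\<dots> = (\<Sum>i\<in>V. (\<Sum>j\<in>V. m i j) * climb (r + \<Delta>) i g)"
    by (simp add: sum_distrib_right)
  also have "\<dots> \<le> (\<Sum>i\<in>V. (\<Sum>j\<in>V. m i j) * a i + p i * \<bar>climb (r + \<Delta>) i g - a i\<bar>)"
  proof (rule sum_mono)
    fix i assume i: "i \<in> V"
    have "(\<Sum>j\<in>V. m i j) * (climb (r + \<Delta>) i g - a i) \<le>
        (\<Sum>j\<in>V. m i j) * \<bar>climb (r + \<Delta>) i g - a i\<bar>"
      using nn i by (intro mult_left_mono sum_nonneg) auto
    also have "\<dots> \<le> p i * \<bar>climb (r + \<Delta>) i g - a i\<bar>"
      using m i by (intro mult_right_mono) (auto simp: matching_def)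
    finally show "(\<Sum>j\<in>V. m i j) * climb (r + \<Delta>) i g \<le>
        (\<Sum>j\<in>V. m i j) * a i + p i * \<bar>climb (r + \<Delta>) i g - a i\<bar>"
      by (simp add: algebra_simps)
  qed
  finally have 1: "(\<Sum>i\<in>V. \<Sum>j\<in>V. m i j * (\<sigma> + climb r j g)) \<le>
      (\<Sum>i\<in>V. (\<Sum>j\<in>V. m i j) * a i) + (\<Sum>i\<in>V. p i * \<bar>climb (r + \<Delta>) i g - a i\<bar>)"
    by (simp add: sum.distrib)
  have "(\<Sum>i\<in>V. \<Sum>j\<in>V. m i j * (\<sigma> + climb r j g)) =
      \<sigma> * (\<Sum>i\<in>V. \<Sum>j\<in>V. m i j) + (\<Sum>i\<in>V. \<Sum>j\<in>V. m i j * climb r j g)"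
    by (simp add: sum_distrib_left sum.distrib algebra_simps)
  also have "(\<Sum>i\<in>V. \<Sum>j\<in>V. m i j * climb r j g) = (\<Sum>j\<in>V. (\<Sum>i\<in>V. m i j) * climb r j g)"
    by (subst sum.swap) (simp add: sum_distrib_right)
  finally have 2: "(\<Sum>i\<in>V. \<Sum>j\<in>V. m i j * (\<sigma> + climb r j g)) =
      \<sigma> * (\<Sum>i\<in>V. \<Sum>j\<in>V. m i j) + (\<Sum>j\<in>V. (\<Sum>i\<in>V. m i j) * climb r j g)" .
  have "(\<Sum>j\<in>V. (\<Sum>i\<in>V. m i j) * b j) \<le>
     (\<Sum>j\<in>V. (\<Sum>i\<in>V. m i j) * climb r j g + p j * \<bar>climb r j g - b j\<bar>)"
  proof (rule sum_mono)
    fix j assume j: "j \<in> V"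
    have "(\<Sum>i\<in>V. m i j) * (b j - climb r j g) \<le> (\<Sum>i\<in>V. m i j) * \<bar>climb r j g - b j\<bar>"
      using nn j by (intro mult_left_mono sum_nonneg) auto
    also have "\<dots> \<le> p j * \<bar>climb r j g - b j\<bar>"
      using m j by (intro mult_right_mono) (auto simp: matching_def)
    finally show "(\<Sum>i\<in>V. m i j) * b j \<le>
        (\<Sum>i\<in>V. m i j) * climb r j g + p j * \<bar>climb r j g - b j\<bar>"
      by (simp add: algebra_simps)
  qed
  then have "(\<Sum>j\<in>V. (\<Sum>i\<in>V. m i j) * b j) \<le>
     (\<Sum>j\<in>V. (\<Sum>i\<in>V. m i j) * climb r j g) + (\<Sum>j\<in>V. p j * \<bar>climb r j g - b j\<bar>)"
    by (simp add: sum.distrib)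
  then show ?thesis using 1 2 by linarith
qed

text \<open>Averaging over \<open>g\<close> makes each of the two deviation terms at most
  \<open>s\<close>. By \<open>sym\<close>, the expected mass received at a vertex equals the
  expected mass \<open>\<rho>\<close> sent, so both sides are the same weighted sum at radii
  \<open>r\<close> and \<open>r + \<Delta>\<close>.\<close>

lemma climb_growth:
  assumes m: "\<And>g. matching \<Delta> \<sigma> g (m g)"
    and sym: "\<And>g i j. m (\<lambda>k. - g k) i j = m g j i"
    and \<rho>: "\<And>i. \<rho> i = rad_mean N (\<lambda>g. \<Sum>j\<in>V. m g i j)"
    and r: "0 \<le> r" "0 \<le> \<Delta>" "2 * (r + \<Delta>) \<le> s\<^sup>2" "0 \<le> s"
  shows "\<sigma> * rad_mean N (\<lambda>g. \<Sum>i\<in>V. \<Sum>j\<in>V. m g i j) + (\<Sum>i\<in>V. \<rho> i * rad_mean N (climb r i)) - 2 * s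
    \<le> (\<Sum>i\<in>V. \<rho> i * rad_mean N (climb (r + \<Delta>) i))"
proof -
  define a where "a i = rad_mean N (climb (r + \<Delta>) i)" for i
  define b where "b i = rad_mean N (climb r i)" for i
  have \<rho>': "\<rho> j = rad_mean N (\<lambda>g. \<Sum>i\<in>V. m g i j)" for j
    unfolding \<rho> by (subst rad_mean_neg[symmetric]) (simp add: sym)
  have "rad_mean N (\<lambda>g. \<sigma> * (\<Sum>i\<in>V. \<Sum>j\<in>V. m g i j) + (\<Sum>j\<in>V. b j * (\<Sum>i\<in>V. m g i j))) \<le>
    rad_mean N (\<lambda>g. (\<Sum>i\<in>V. a i * (\<Sum>j\<in>V. m g i j)) + (\<Sum>i\<in>V. p i * \<bar>climb (r + \<Delta>) i g - a i\<bar>)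
     + (\<Sum>i\<in>V. p i * \<bar>climb r i g - b i\<bar>))"
    by (intro rad_mean_mono) (use climb_growth_pointwise[OF m r(1)] in \<open>simp only: mult.commute\<close>)
  also have "\<dots> = (\<Sum>i\<in>V. a i * \<rho> i) +
      (\<Sum>i\<in>V. p i * rad_mean N (\<lambda>g. \<bar>climb (r + \<Delta>) i g - a i\<bar>)) +
      (\<Sum>i\<in>V. p i * rad_mean N (\<lambda>g. \<bar>climb r i g - b i\<bar>))"
    unfolding rad_mean_add rad_mean_sum[of N _ V] rad_mean_cmult \<rho> by simp
  also have "\<dots> \<le> (\<Sum>i\<in>V. a i * \<rho> i) + (\<Sum>i\<in>V. p i * s) + (\<Sum>i\<in>V. p i * s)"
    unfolding a_def b_def
    by (intro add_mono order_refl sum_mono mult_left_mono climb_deviation p) (use r in auto)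
  also have "\<dots> = (\<Sum>i\<in>V. a i * \<rho> i) + 2 * s"
    using p_sum by (simp flip: sum_distrib_right)
  also have "rad_mean N (\<lambda>g. \<sigma> * (\<Sum>i\<in>V. \<Sum>j\<in>V. m g i j) + (\<Sum>j\<in>V. b j * (\<Sum>i\<in>V. m g i j))) =
     \<sigma> * rad_mean N (\<lambda>g. \<Sum>i\<in>V. \<Sum>j\<in>V. m g i j) + (\<Sum>j\<in>V. b j * \<rho> j)"
    unfolding rad_mean_add rad_mean_sum[of N "\<lambda>j g. b j * (\<Sum>i\<in>V. m g i j)" V] rad_mean_cmult \<rho>' ..
  finally show ?thesis by (simp add: a_def b_def mult.commute)
qed

text \<open>Each of the \<open>K\<close> steps gains at least
  \<open>\<sigma> * \<mu> = 2 * \<eta>\<close>. The hypothesis on \<open>K\<close> allows the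
  deviation bound \<open>\<sigma> * \<mu> / 4\<close> at every radius used, which costs
  \<open>\<eta>\<close>, so \<open>\<Phi> K\<close> is at least \<open>K * \<eta>\<close>. The
  subgaussian bound for maxima limits \<open>\<Phi> K\<close> from above.\<close>

lemma matching_chain_bound_sym:
  assumes m: "\<And>g. matching \<Delta> \<sigma> g (m g)"
    and sym: "\<And>g i j. m (\<lambda>k. - g k) i j = m g j i"
    and \<mu>: "\<mu> \<le> rad_mean N (\<lambda>g. \<Sum>i\<in>V. \<Sum>j\<in>V. m g i j)"
    and pos: "0 < \<Delta>" "0 < \<sigma>" "0 < \<mu>"
    and K: "2 * (real K * \<Delta>) \<le> (\<sigma> * \<mu> / 4)\<^sup>2"
  shows "real K * (\<sigma> * \<mu> / 2)\<^sup>2 \<le> 2 * \<Delta> * ln (real (card V))"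
proof -
  define \<eta> where "\<eta> = \<sigma> * \<mu> / 2"
  define \<rho> where "\<rho> i = rad_mean N (\<lambda>g. \<Sum>j\<in>V. m g i j)" for i
  define \<Phi> where "\<Phi> k = (\<Sum>i\<in>V. \<rho> i * rad_mean N (climb (real k * \<Delta>) i))" for k
  have \<eta>: "\<eta> > 0" using pos by (simp add: \<eta>_def)
  have \<rho>0: "0 \<le> \<rho> i" if "i \<in> V" for i
    unfolding \<rho>_def by (intro rad_mean_nonneg sum_nonneg) (use m that in \<open>auto simp: matching_def\<close>)
  have "\<rho> i \<le> p i" if "i \<in> V" for i
  proof -
    have "\<rho> i \<le> rad_mean N (\<lambda>_. p i)"
      unfolding \<rho>_def by (intro rad_mean_mono) (use m that in \<open>auto simp: matching_def\<close>)
    then show ?thesis by simp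
  qed
  then have \<rho>1: "sum \<rho> V \<le> 1" using sum_mono[of V \<rho> p] p_sum by simp
  have lower: "k \<le> K \<Longrightarrow> real k * \<eta> \<le> \<Phi> k" for k
  proof (induction k)
    case 0
    have "0 \<le> climb 0 i g" if "i \<in> V" for i g
      using climb_ge[of i 0 i g] that by (simp add: near_def)
    then have "0 \<le> \<Phi> 0"
      unfolding \<Phi>_def by (auto intro!: sum_nonneg mult_nonneg_nonneg \<rho>0 rad_mean_nonneg)
    then show ?case by simp
  next
    case (Suc k)
    have "real k * \<Delta> + \<Delta> = real (Suc k) * \<Delta>" by (simp add: algebra_simps)
    moreover have "real (Suc k) * \<Delta> \<le> real K * \<Delta>"
      using Suc.prems pos by (intro mult_right_mono) auto
    ultimately have "2 * (real k * \<Delta> + \<Delta>) \<le> (\<sigma> * \<mu> / 4)\<^sup>2" using K by simp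
    from climb_growth[OF m sym \<rho>_def _ _ this]
    have "\<sigma> * rad_mean N (\<lambda>g. \<Sum>i\<in>V. \<Sum>j\<in>V. m g i j) + \<Phi> k - \<eta> \<le> \<Phi> (Suc k)"
      using pos by (simp add: \<Phi>_def \<eta>_def algebra_simps)
    moreover have "2 * \<eta> \<le> \<sigma> * rad_mean N (\<lambda>g. \<Sum>i\<in>V. \<Sum>j\<in>V. m g i j)"
      using \<mu> pos by (simp add: \<eta>_def)
    ultimately have "\<Phi> k + \<eta> \<le> \<Phi> (Suc k)" by linarith
    then show ?case using Suc by (simp add: algebra_simps)
  qed
  \<comment> \<open>With this \<open>t\<close> the quadratic term of the upper bound is exactly half
    of the lower bound and can be absorbed.\<close>
  define t where "t = \<eta> / \<Delta>"
  have t: "t > 0" using \<eta> pos by (simp add: t_def)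
  define U where "U = ln (real (card V)) + t\<^sup>2 * (real K * \<Delta>) / 2"
  have "V \<noteq> {}" using p_sum by auto
  then have U0: "0 \<le> U"
    using V pos by (auto simp: U_def card_gt_0_iff Suc_leI intro!: add_nonneg_nonneg)
  have "t * \<Phi> K = (\<Sum>i\<in>V. \<rho> i * (t * rad_mean N (climb (real K * \<Delta>) i)))"
    by (simp add: \<Phi>_def sum_distrib_left algebra_simps)
  also have "\<dots> \<le> (\<Sum>i\<in>V. \<rho> i * U)"
    unfolding U_def by (intro sum_mono mult_left_mono climb_mean_le \<rho>0) (use pos in auto)
  also have "\<dots> \<le> 1 * U"
    unfolding sum_distrib_right[symmetric] by (rule mult_right_mono[OF \<rho>1 U0])
  finally have "t * (real K * \<eta>) \<le> U"
    using mult_left_mono[OF lower[OF order_refl], of t] t by linarith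
  then have "t * (real K * \<eta>) * \<Delta> \<le> U * \<Delta>"
    using pos by (intro mult_right_mono) auto
  also have "U * \<Delta> = ln (real (card V)) * \<Delta> + t\<^sup>2 * (real K * \<Delta>) * \<Delta> / 2"
    by (simp add: U_def algebra_simps)
  also have "t * (real K * \<eta>) * \<Delta> = real K * \<eta>\<^sup>2"
    using pos by (simp add: t_def power2_eq_square)
  also have "t\<^sup>2 * (real K * \<Delta>) * \<Delta> = real K * \<eta>\<^sup>2"
    using pos by (simp add: t_def power2_eq_square)
  finally have "real K * \<eta>\<^sup>2 \<le> ln (real (card V)) * \<Delta> + real K * \<eta>\<^sup>2 / 2" .
  then show ?thesis by (simp add: \<eta>_def algebra_simps)
qed

lemma matching_chain_bound:
  assumes m: "\<And>g. matching \<Delta> \<sigma> g (m g)"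
    and \<mu>: "\<mu> \<le> rad_mean N (\<lambda>g. \<Sum>i\<in>V. \<Sum>j\<in>V. m g i j)"
    and pos: "0 < \<Delta>" "0 < \<sigma>" "0 < \<mu>"
    and K: "2 * (real K * \<Delta>) \<le> (\<sigma> * \<mu> / 4)\<^sup>2"
  shows "real K * (\<sigma> * \<mu> / 2)\<^sup>2 \<le> 2 * \<Delta> * ln (real (card V))"
proof -
  \<comment> \<open>antisymmetry in g makes the expected outgoing and incoming matched mass at a vertex equal\<close>
  define m' where "m' g i j = (m g i j + m (\<lambda>k. - g k) j i) / 2" for g i j
  show ?thesis
  proof (rule matching_chain_bound_sym[of \<Delta> \<sigma> m'])
    show "m' (\<lambda>k. - g k) i j = m' g j i" for g i j by (simp add: m'_def)
    show "matching \<Delta> \<sigma> g (m' g)" for g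
    proof -
      have "d i j \<le> \<Delta> \<and> \<sigma> \<le> step g i j" if "i \<in> V" "j \<in> V" "m' g i j \<noteq> 0" for i j
      proof (cases "m g i j = 0")
        case True
        then have "m (\<lambda>k. - g k) j i \<noteq> 0" using that by (simp add: m'_def)
        then have "d j i \<le> \<Delta> \<and> \<sigma> \<le> step (\<lambda>k. - g k) j i"
          using m[of "\<lambda>k. - g k"] that by (auto simp: matching_def)
        then show ?thesis by (simp add: d_commute step_neg)
      next
        case False
        then show ?thesis using m[of g] that by (auto simp: matching_def)
      qed
      moreover have "(\<Sum>j\<in>V. m' g i j) \<le> p i" "(\<Sum>j\<in>V. m' g j i) \<le> p i" if "i \<in> V" for i
        using m[of g] m[of "\<lambda>k. - g k"] that
        by (auto simp: m'_def matching_def sum.distrib simp flip: sum_divide_distrib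
            dest!: bspec[OF _ that])
      moreover have "0 \<le> m' g i j" if "i \<in> V" "j \<in> V" for i j
        using m[of g] m[of "\<lambda>k. - g k"] that by (auto simp: m'_def matching_def)
      ultimately show ?thesis unfolding matching_def by blast
    qed
    have "(\<Sum>i\<in>V. \<Sum>j\<in>V. m' g i j) = ((\<Sum>i\<in>V. \<Sum>j\<in>V. m g i j) + (\<Sum>i\<in>V. \<Sum>j\<in>V. m (\<lambda>k. - g k) i j)) / 2" for g
      unfolding m'_def by (subst (3) sum.swap) (simp add: sum.distrib flip: sum_divide_distrib)
    then have "rad_mean N (\<lambda>g. \<Sum>i\<in>V. \<Sum>j\<in>V. m' g i j) =
       rad_mean N (\<lambda>g. (1/2) * (\<Sum>i\<in>V. \<Sum>j\<in>V. m g i j) + (1/2) * (\<Sum>i\<in>V. \<Sum>j\<in>V. m (\<lambda>k. - g k) i j))"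
      by (simp add: add_divide_distrib)
    also have "\<dots> = rad_mean N (\<lambda>g. \<Sum>i\<in>V. \<Sum>j\<in>V. m g i j)"
      unfolding rad_mean_add rad_mean_cmult
      using rad_mean_neg[of N "\<lambda>g. \<Sum>i\<in>V. \<Sum>j\<in>V. m g i j"] by simp
    finally show "\<mu> \<le> rad_mean N (\<lambda>g. \<Sum>i\<in>V. \<Sum>j\<in>V. m' g i j)" using \<mu> by simp
  qed (use pos K in auto)
qed

section \<open>Heavy separated sets\<close>

definition separated :: "real \<Rightarrow> real \<Rightarrow> 'a set \<Rightarrow> 'a set \<Rightarrow> bool" where
  "separated \<delta> \<Delta> A B \<longleftrightarrow> A \<subseteq> V \<and> B \<subseteq> V \<and> \<delta> \<le> sum p A \<and> \<delta> \<le> sum p B \<and>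
     (\<forall>i\<in>A. \<forall>j\<in>B. \<Delta> < d i j)"

text \<open>The mass of pairs that direction \<open>g\<close> stretches; the factor 2 anticipates
  the halving at the median.\<close>

definition spread :: "real \<Rightarrow> (nat \<Rightarrow> real) \<Rightarrow> real" where
  "spread \<sigma> g = (\<Sum>i\<in>V. \<Sum>j\<in>V. p i * p j * of_bool (2 * \<sigma> \<le> \<bar>step g i j\<bar>))"

text \<open>The low set \<open>B\<close> and the high set \<open>A\<close> are matched greedily
  along pairs within distance \<open>\<Delta>\<close>. Their unsaturated parts are more than
  \<open>\<Delta>\<close> apart, so one of them has mass below \<open>\<delta>\<close>; on that side
  everything else is saturated.\<close>

lemma matching_exists:
  assumes nosep: "\<And>A B. \<not> separated \<delta> \<Delta> A B" and "0 < \<sigma>"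
  shows "\<exists>m. matching \<Delta> \<sigma> g m \<and> spread \<sigma> g / 4 - \<delta> \<le> (\<Sum>i\<in>V. \<Sum>j\<in>V. m i j)"
proof -
  define x where "x i = rad_form N g (v i)" for i
  have step: "step g i j = x j - x i" for i j by (simp add: step_def x_def rad_form_diff)
  have "spread \<sigma> g = (\<Sum>i\<in>V. \<Sum>j\<in>V. p i * p j * of_bool (\<bar>x i - x j\<bar> \<ge> 2 * \<sigma>))"
    by (simp add: spread_def step abs_minus_commute)
  then have "\<exists>A B. A \<subseteq> V \<and> B \<subseteq> V \<and> spread \<sigma> g / 4 \<le> sum p A \<and> spread \<sigma> g / 4 \<le> sum p B \<and>
      (\<forall>i\<in>B. \<forall>j\<in>A. \<sigma> \<le> step g i j)"
    unfolding step by (intro spread_halves[OF V _ p_sum \<open>0 < \<sigma>\<close>] p)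
  then obtain A B where AB: "A \<subseteq> V" "B \<subseteq> V"
    "spread \<sigma> g / 4 \<le> sum p A" "spread \<sigma> g / 4 \<le> sum p B"
    "\<forall>i\<in>B. \<forall>j\<in>A. \<sigma> \<le> step g i j"
    by (elim exE conjE)
  define P where "P = {(i, j) \<in> B \<times> A. d i j \<le> \<Delta>}"
  \<comment> \<open>The value 0 outside \<open>V\<close> gives capacities that are nonnegative
    everywhere, as the greedy construction requires.\<close>
  define \<alpha> where "\<alpha> i = (if i \<in> V then p i else 0)" for i
  have "P \<subseteq> B \<times> A" by (auto simp: P_def)
  also have "\<dots> \<subseteq> V \<times> V" using AB by (intro Sigma_mono)
  finally have P: "P \<subseteq> V \<times> V" .
  then have finP: "finite P" by (rule finite_subset) (use V in simp)
  have \<alpha>: "0 \<le> \<alpha> i" for i using p by (simp add: \<alpha>_def)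
  obtain m where m: "\<forall>i j. 0 \<le> m i j" "\<forall>i j. (i, j) \<notin> P \<longrightarrow> m i j = 0"
    "\<forall>i. (\<Sum>j\<in>V. m i j) \<le> \<alpha> i" "\<forall>j. (\<Sum>i\<in>V. m i j) \<le> \<alpha> j"
    "\<forall>(i, j)\<in>P. (\<Sum>j\<in>V. m i j) = \<alpha> i \<or> (\<Sum>i\<in>V. m i j) = \<alpha> j"
    using greedy_matching[of P V \<alpha> \<alpha>, OF finP V P \<alpha> \<alpha>] by (elim exE conjE)
  have matching: "matching \<Delta> \<sigma> g m"
    unfolding matching_def
  proof (intro conjI ballI impI)
    fix i j assume ij: "i \<in> V" "j \<in> V" "m i j \<noteq> 0"
    then have "(i, j) \<in> P" using m(2) by blast
    then show "d i j \<le> \<Delta>" "\<sigma> \<le> step g i j" using AB(5) by (auto simp: P_def)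
  next
    fix i assume "i \<in> V"
    then show "(\<Sum>j\<in>V. m i j) \<le> p i" "(\<Sum>j\<in>V. m j i) \<le> p i"
      using m(3,4)[rule_format, of i] by (simp_all add: \<alpha>_def)
  qed (use m(1) in auto)
  define B' where "B' = {i\<in>B. (\<Sum>j\<in>V. m i j) \<noteq> p i}"
  define A' where "A' = {j\<in>A. (\<Sum>i\<in>V. m i j) \<noteq> p j}"
  have sub: "B' \<subseteq> B" "A' \<subseteq> A" by (auto simp: A'_def B'_def)
  have fin: "finite A" "finite B" using AB V finite_subset by auto
  have "\<Delta> < d i j" if "i \<in> B'" "j \<in> A'" for i j
  proof (rule ccontr)
    assume "\<not> \<Delta> < d i j"
    then have "(i, j) \<in> P" using that by (auto simp: P_def A'_def B'_def)
    then have "(\<Sum>j\<in>V. m i j) = \<alpha> i \<or> (\<Sum>i\<in>V. m i j) = \<alpha> j" using m(5) by blast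
    then show False using that AB by (auto simp: A'_def B'_def \<alpha>_def)
  qed
  then have "sum p B' < \<delta> \<or> sum p A' < \<delta>"
    using nosep[of B' A'] sub AB by (auto simp: separated_def)
  then have "spread \<sigma> g / 4 - \<delta> \<le> (\<Sum>i\<in>V. \<Sum>j\<in>V. m i j)"
  proof
    assume "sum p B' < \<delta>"
    then have "spread \<sigma> g / 4 - \<delta> \<le> sum p (B - B')"
      using AB(4) sum_diff[OF fin(2) sub(1), of p] by simp
    also have "\<dots> = (\<Sum>i\<in>B - B'. \<Sum>j\<in>V. m i j)" by (intro sum.cong) (auto simp: B'_def)
    also have "\<dots> \<le> (\<Sum>i\<in>V. \<Sum>j\<in>V. m i j)"
      using V AB(2) m(1) by (intro sum_mono2) (auto intro: sum_nonneg)
    finally show ?thesis .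
  next
    assume "sum p A' < \<delta>"
    then have "spread \<sigma> g / 4 - \<delta> \<le> sum p (A - A')"
      using AB(3) sum_diff[OF fin(1) sub(2), of p] by simp
    also have "\<dots> = (\<Sum>j\<in>A - A'. \<Sum>i\<in>V. m i j)" by (intro sum.cong) (auto simp: A'_def)
    also have "\<dots> \<le> (\<Sum>j\<in>V. \<Sum>i\<in>V. m i j)"
      using V AB(1) m(1) by (intro sum_mono2) (auto intro: sum_nonneg)
    also have "\<dots> = (\<Sum>i\<in>V. \<Sum>j\<in>V. m i j)" by (rule sum.swap)
    finally show ?thesis .
  qed
  then show ?thesis using matching by blast
qed

text \<open>From each \<open>i\<close> at least half of the mass is at squared distance 1/4 or more.
  Such a pair has squared projection at least 1/8, hence projection at least 1/4, with probability
  1/10 or more.\<close>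

lemma spread_mean_ge:
  assumes dense: "\<And>i. i \<in> V \<Longrightarrow> sum p (near (1/4) i) \<le> 1/2"
  shows "1 / 20 \<le> rad_mean N (spread (1/8))"
proof -
  have far: "(\<Sum>j\<in>V. p j * of_bool (1/4 \<le> d i j)) \<ge> 1/2" if i: "i \<in> V" for i
  proof -
    have "near (1/4) i \<subseteq> V" by (auto simp: near_def)
    from sum.subset_diff[OF this V, of p]
    have "1 = sum p (V - near (1/4) i) + sum p (near (1/4) i)" by (simp add: p_sum)
    also have "sum p (V - near (1/4) i) =
        (\<Sum>j\<in>V - near (1/4) i. p j * of_bool (1/4 \<le> d i j))"
      by (intro sum.cong) (auto simp: near_def)
    also have "\<dots> \<le> (\<Sum>j\<in>V. p j * of_bool (1/4 \<le> d i j))"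
      using V p by (intro sum_mono2) auto
    finally show ?thesis using dense[OF i] by linarith
  qed
  have "1 / 20 = (\<Sum>i\<in>V. p i * (1 / 20))" using p_sum by (simp flip: sum_divide_distrib)
  also have "\<dots> \<le> (\<Sum>i\<in>V. p i * ((\<Sum>j\<in>V. p j * of_bool (1/4 \<le> d i j)) * (1/10)))"
    by (intro sum_mono mult_left_mono p) (use far in fastforce)
  also have "\<dots> = (\<Sum>i\<in>V. \<Sum>j\<in>V. p i * p j * (of_bool (1/4 \<le> d i j) * (1/10)))"
    by (simp add: sum_distrib_left sum_distrib_right algebra_simps)
  also have "\<dots> \<le> (\<Sum>i\<in>V. \<Sum>j\<in>V. p i * p j * rad_mean N (\<lambda>g. of_bool (2 * (1/8) \<le> \<bar>step g i j\<bar>)))"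
  proof (intro sum_mono mult_left_mono)
    fix i j
    show "of_bool (1/4 \<le> d i j) * (1/10) \<le> rad_mean N (\<lambda>g. of_bool (2 * (1/8) \<le> \<bar>step g i j\<bar>))"
    proof (cases "1/4 \<le> d i j")
      case True
      have "1/10 \<le> rad_mean N (\<lambda>g. of_bool ((step g i j)\<^sup>2 \<ge> d j i / 2))"
        unfolding step_def d_def by (rule rad_mean_paley_zygmund)
      also have "\<dots> \<le> rad_mean N (\<lambda>g. of_bool (2 * (1/8) \<le> \<bar>step g i j\<bar>))"
      proof (rule rad_mean_mono)
        fix g
        have "1/4 \<le> \<bar>step g i j\<bar>" if "(step g i j)\<^sup>2 \<ge> d j i / 2"
        proof (rule ccontr)
          assume "\<not> 1/4 \<le> \<bar>step g i j\<bar>"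
          then have "\<bar>step g i j\<bar>\<^sup>2 < (1/4)\<^sup>2" by (intro power_strict_mono) auto
          then show False using that True by (simp add: d_commute power_divide)
        qed
        then show "of_bool ((step g i j)\<^sup>2 \<ge> d j i / 2) \<le>
            (of_bool (2 * (1/8) \<le> \<bar>step g i j\<bar>) :: real)"
          by auto
      qed
      finally show ?thesis using True by simp
    qed (simp add: rad_mean_nonneg)
  qed (use p in auto)
  also have "\<dots> = rad_mean N (spread (1/8))"
    unfolding spread_def rad_mean_sum rad_mean_cmult ..
  finally show ?thesis .
qed

text \<open>Without separated sets every direction has a matching, of mean mass at least 1/80 -
  1/160 = 1/160. With \<open>\<sigma> = 1/8\<close> this gives
  \<open>\<sigma> * \<mu> / 4 = 1/5120\<close>, and a chain of length about
  \<open>e / \<Delta>\<close> contradicts \<open>matching_chain_bound\<close>.\<close>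

lemma separated_exists:
  assumes dense: "\<And>i. i \<in> V \<Longrightarrow> sum p (near (1/4) i) \<le> 1/2"
    and \<Delta>: "0 < \<Delta>" "\<Delta> \<le> (1/5120)\<^sup>2 / 2" "\<Delta>\<^sup>2 * ln (real (card V)) \<le> ((1/5120)\<^sup>2 / 4)\<^sup>2"
  shows "\<exists>A B. separated (1/160) \<Delta> A B"
proof (rule ccontr)
  assume "\<not> ?thesis"
  then have "\<exists>m. matching \<Delta> (1/8) g m \<and>
      spread (1/8) g / 4 - 1/160 \<le> (\<Sum>i\<in>V. \<Sum>j\<in>V. m i j)" for g
    by (intro matching_exists) auto
  then obtain m where m: "\<And>g. matching \<Delta> (1/8) g (m g)"
    "\<And>g. spread (1/8) g / 4 - 1/160 \<le> (\<Sum>i\<in>V. \<Sum>j\<in>V. m g i j)"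
    by metis
  have "1/160 \<le> (1/4) * rad_mean N (spread (1/8)) - 1/160"
    using spread_mean_ge[OF dense] by simp
  also have "\<dots> = rad_mean N (\<lambda>g. (1/4) * spread (1/8) g - 1/160)"
    unfolding rad_mean_diff rad_mean_cmult by simp
  also have "\<dots> \<le> rad_mean N (\<lambda>g. \<Sum>i\<in>V. \<Sum>j\<in>V. m g i j)"
    using m(2) by (intro rad_mean_mono) simp
  finally have \<mu>: "1/160 \<le> rad_mean N (\<lambda>g. \<Sum>i\<in>V. \<Sum>j\<in>V. m g i j)" .
  \<comment> \<open>\<open>e\<close> is the largest value of \<open>K * \<Delta>\<close> that the
    chain bound admits. Since \<open>\<Delta> \<le> e\<close>, rounding to an integer
    \<open>K\<close> loses at most a factor 2.\<close>
  define e :: real where "e = (1/5120)\<^sup>2 / 2"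
  define K where "K = nat \<lfloor>e / \<Delta>\<rfloor>"
  have e\<Delta>: "1 \<le> e / \<Delta>" using \<Delta> by (simp add: e_def)
  then have "1 \<le> \<lfloor>e / \<Delta>\<rfloor>" by simp
  then have K: "real K \<le> e / \<Delta>" "e / \<Delta> < real K + 1" "1 \<le> real K"
    unfolding K_def by linarith+
  then have K2: "real K * \<Delta> \<le> e" "e \<le> 2 * (real K * \<Delta>)"
  proof -
    show "real K * \<Delta> \<le> e" using K(1) \<Delta>(1) by (simp add: pos_le_divide_eq)
    have "e / \<Delta> \<le> 2 * real K" using K by linarith
    then show "e \<le> 2 * (real K * \<Delta>)" using \<Delta>(1) by (simp add: pos_divide_le_eq)
  qed
  have "2 * (real K * \<Delta>) \<le> ((1/8) * (1/160) / 4)\<^sup>2"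
    using K2(1) by (simp add: e_def power2_eq_square)
  from matching_chain_bound[OF m(1) \<mu> \<Delta>(1) _ _ this]
  have "real K * (1/2560)\<^sup>2 \<le> 2 * \<Delta> * ln (real (card V))" by simp
  then have "real K * (1/2560)\<^sup>2 * \<Delta> \<le> 2 * \<Delta> * ln (real (card V)) * \<Delta>"
    using \<Delta>(1) by (intro mult_right_mono) auto
  also have "\<dots> = 2 * (\<Delta>\<^sup>2 * ln (real (card V)))" by (simp add: power2_eq_square)
  also have "\<dots> \<le> 2 * ((1/5120)\<^sup>2 / 4)\<^sup>2" using \<Delta>(3) by simp
  finally have K\<Delta>: "real K * \<Delta> * (1/2560)\<^sup>2 \<le> 2 * ((1/5120)\<^sup>2 / 4)\<^sup>2" by (simp add: mult_ac)
  have "e * (1/2560)\<^sup>2 \<le> 2 * (real K * \<Delta>) * (1/2560)\<^sup>2"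
    using K2(2) by (rule mult_right_mono) simp
  also have "\<dots> = 2 * (real K * \<Delta> * (1/2560)\<^sup>2)" by (simp only: mult.assoc)
  also have "\<dots> \<le> 2 * (2 * ((1/5120)\<^sup>2 / 4)\<^sup>2)" using K\<Delta> by (rule mult_left_mono) simp
  finally have "e * (1/2560)\<^sup>2 \<le> 2 * (2 * ((1/5120)\<^sup>2 / 4)\<^sup>2)" .
  then show False by (simp add: e_def power2_eq_square)
qed

subsection \<open>Gaps of Lipschitz functions\<close>

definition dist_to :: "'a set \<Rightarrow> 'a \<Rightarrow> real" where
  "dist_to A i = Min (d i ` A)"

lemma dist_to:
  assumes "A \<subseteq> V" "A \<noteq> {}"
  shows "a \<in> A \<Longrightarrow> dist_to A i \<le> d i a" "\<exists>a\<in>A. dist_to A i = d i a"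
proof -
  have A: "finite (d i ` A)" "d i ` A \<noteq> {}" using assms V finite_subset by auto
  show "dist_to A i \<le> d i a" if "a \<in> A" unfolding dist_to_def using A(1) that by simp
  show "\<exists>a\<in>A. dist_to A i = d i a" using Min_in[OF A] unfolding dist_to_def by auto
qed

lemma dist_to_lipschitz:
  assumes "A \<subseteq> V" "A \<noteq> {}" "i \<in> V" "j \<in> V"
  shows "dist_to A j - dist_to A i \<le> d i j"
proof -
  obtain a where a: "a \<in> A" "dist_to A i = d i a" using dist_to(2)[OF assms(1,2)] by blast
  then have "dist_to A j \<le> d j i + d i a"
    using dist_to(1)[OF assms(1,2) a(1), of j] triangle[of j a i] assms by auto
  then show ?thesis using a d_commute[of i j] by simp
qed

lemma dist_to_nonneg: "A \<subseteq> V \<Longrightarrow> A \<noteq> {} \<Longrightarrow> 0 \<le> dist_to A i"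
  using dist_to(2) d_nonneg by metis

lemma dist_to_self: "A \<subseteq> V \<Longrightarrow> a \<in> A \<Longrightarrow> dist_to A a = 0"
  using dist_to(1)[of A a a] dist_to_nonneg[of A a] by fastforce

text \<open>A dual certificate in Kantorovich's sense: the 1-Lipschitz \<open>f\<close> shows that
  moving \<open>a\<close> to \<open>b\<close> costs at least \<open>c\<close> with respect to
  \<open>d\<close>.\<close>

definition transport_gap :: "real \<Rightarrow> bool" where
  "transport_gap c \<longleftrightarrow> (\<exists>f a b. (\<forall>i\<in>V. 0 \<le> a i \<and> a i \<le> p i \<and> 0 \<le> b i \<and> b i \<le> p i) \<and>
     sum a V = sum b V \<and> (\<forall>i\<in>V. \<forall>j\<in>V. f j - f i \<le> d i j) \<and> c \<le> (\<Sum>i\<in>V. (b i - a i) * f i))"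

text \<open>The distance to \<open>A\<close> vanishes on \<open>A\<close> and is at least
  \<open>\<Delta>\<close> on \<open>B\<close>; mass \<open>\<delta>\<close> is moved from
  \<open>A\<close> to \<open>B\<close>.\<close>

lemma transport_gap_separated:
  assumes sep: "separated \<delta> \<Delta> A B" and "0 < \<delta>"
  shows "transport_gap (\<delta> * \<Delta>)"
proof -
  have AB: "A \<subseteq> V" "B \<subseteq> V" "\<delta> \<le> sum p A" "\<delta> \<le> sum p B" "A \<noteq> {}"
    using sep \<open>0 < \<delta>\<close> by (auto simp: separated_def)
  \<comment> \<open>\<open>p\<close> restricted to \<open>S\<close> and scaled down to total mass
    \<open>\<delta>\<close>.\<close>
  define a where "a S i = of_bool (i \<in> S) * (p i * (\<delta> / sum p S))" for S i
  have bounds: "0 \<le> a S i" "a S i \<le> p i" if "i \<in> V" "\<delta> \<le> sum p S" for S i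
  proof -
    have "\<delta> / sum p S \<le> 1" "0 \<le> \<delta> / sum p S" using that(2) \<open>0 < \<delta>\<close> by auto
    then show "0 \<le> a S i" "a S i \<le> p i"
      using p[OF that(1)] mult_left_mono[of "\<delta> / sum p S" 1 "p i"]
        mult_nonneg_nonneg[of "p i" "\<delta> / sum p S"]
      by (auto simp: a_def)
  qed
  have sum_a: "(\<Sum>i\<in>V. a S i * f i) = (\<Sum>i\<in>S. p i * f i) * (\<delta> / sum p S)" if "S \<subseteq> V" for S f
  proof -
    have "(\<Sum>i\<in>V. a S i * f i) = (\<Sum>i\<in>S. a S i * f i)"
      using that V by (intro sum.mono_neutral_right) (auto simp: a_def)
    then show ?thesis by (simp add: a_def sum_distrib_left sum_distrib_right mult_ac)
  qed
  have total: "sum (a S) V = \<delta>" if "S \<subseteq> V" "\<delta> \<le> sum p S" for S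
    using sum_a[OF that(1), of "\<lambda>_. 1"] that \<open>0 < \<delta>\<close> by simp
  let ?f = "dist_to A"
  have "\<delta> * \<Delta> = (\<Sum>i\<in>B. p i * \<Delta>) * (\<delta> / sum p B)"
    using AB(4) \<open>0 < \<delta>\<close> by (simp flip: sum_distrib_right)
  also have "\<dots> \<le> (\<Sum>i\<in>B. p i * ?f i) * (\<delta> / sum p B)"
  proof (intro mult_right_mono sum_mono mult_left_mono)
    fix i assume i: "i \<in> B"
    obtain x where "x \<in> A" "?f i = d i x" using dist_to(2)[OF AB(1,5)] by blast
    then show "\<Delta> \<le> ?f i" using sep i d_commute[of i x] by (force simp: separated_def)
    show "0 \<le> p i" using i AB p by auto
  qed (use AB \<open>0 < \<delta>\<close> in auto)
  also have "\<dots> = (\<Sum>i\<in>V. a B i * ?f i)" using sum_a[OF AB(2)] by simp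
  also have "\<dots> = (\<Sum>i\<in>V. (a B i - a A i) * ?f i)"
  proof -
    have "(\<Sum>i\<in>V. a A i * ?f i) = 0" unfolding sum_a[OF AB(1)]
      using dist_to_self[OF AB(1)] by simp
    then show ?thesis by (simp add: left_diff_distrib sum_subtractf)
  qed
  finally show ?thesis
    unfolding transport_gap_def
    using bounds AB total dist_to_lipschitz[OF AB(1,5)]
    by (intro exI[of _ ?f] exI[of _ "a A"] exI[of _ "a B"]) auto
qed

text \<open>Mean squared distance 2 forces mean distance at least 1 from \<open>i0\<close>, hence at
  least 3/4 from the ball \<open>C\<close>. The mass \<open>M \<ge> 1/2\<close> of \<open>C\<close>
  is redistributed over \<open>V\<close> in proportion to \<open>p\<close>, which gains at least
  3/8.\<close>

lemma transport_gap_cluster: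
  assumes i0: "i0 \<in> V" and mass: "1/2 \<le> sum p (near (1/4) i0)"
    and d2: "(\<Sum>i\<in>V. \<Sum>j\<in>V. p i * p j * d i j) = 2"
  shows "transport_gap (3/8)"
proof -
  define C where "C = near (1/4) i0"
  have "i0 \<in> C" using i0 by (simp add: C_def near_def)
  then have C: "C \<subseteq> V" "C \<noteq> {}" by (auto simp: C_def near_def)
  let ?f = "dist_to C"
  define M where "M = sum p C"
  have M: "1/2 \<le> M" "M \<le> 1" using mass sum_mono2[OF V C(1), of p] p p_sum by (auto simp: M_def C_def)
  have f_ge: "d i i0 - 1/4 \<le> ?f i" if i: "i \<in> V" for i
  proof -
    obtain x where x: "x \<in> C" "?f i = d i x" using dist_to(2)[OF C] by blast
    then show ?thesis using triangle[of i i0 x] i i0 C d_commute[of x i0]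
      by (auto simp: C_def near_def)
  qed
  have "2 \<le> (\<Sum>i\<in>V. \<Sum>j\<in>V. p i * p j * (d i i0 + d j i0))"
    unfolding d2[symmetric]
    using triangle i0 p d_commute by (intro sum_mono mult_left_mono) auto
  also have "\<dots> = (\<Sum>i\<in>V. \<Sum>j\<in>V. p j * (p i * d i i0) + p i * (p j * d j i0))"
    by (simp add: algebra_simps)
  also have "\<dots> = 2 * (\<Sum>i\<in>V. p i * d i i0)"
    using p_sum by (simp add: sum.distrib flip: sum_distrib_left sum_distrib_right)
  finally have "1 \<le> (\<Sum>i\<in>V. p i * d i i0)" by simp
  also have "\<dots> \<le> (\<Sum>i\<in>V. p i * (?f i + 1/4))"
    using f_ge by (intro sum_mono mult_left_mono p) (auto simp: algebra_simps)
  also have "\<dots> = (\<Sum>i\<in>V. p i * ?f i) + 1/4"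
    using p_sum by (simp add: distrib_left sum.distrib flip: sum_divide_distrib)
  finally have pf: "3/4 \<le> (\<Sum>i\<in>V. p i * ?f i)" by simp
  define a where "a i = of_bool (i \<in> C) * p i" for i
  have "sum a V = M"
    unfolding M_def using C V by (intro sum.mono_neutral_cong_right) (auto simp: a_def)
  moreover have "(\<Sum>i\<in>V. M * p i) = M" using p_sum by (simp flip: sum_distrib_left)
  moreover have "3/8 \<le> (\<Sum>i\<in>V. (M * p i - a i) * ?f i)"
  proof -
    have "(1/2) * (3/4) \<le> M * (\<Sum>i\<in>V. p i * ?f i)"
      using M pf by (intro mult_mono) auto
    moreover have "(\<Sum>i\<in>V. a i * ?f i) = 0"
      using dist_to_self[OF C(1)] by (intro sum.neutral) (auto simp: a_def)
    moreover have "(\<Sum>i\<in>V. (M * p i - a i) * ?f i) =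
        M * (\<Sum>i\<in>V. p i * ?f i) - (\<Sum>i\<in>V. a i * ?f i)"
      by (simp only: left_diff_distrib sum_subtractf sum_distrib_left mult.assoc)
    ultimately show ?thesis by simp
  qed
  moreover have "0 \<le> a i \<and> a i \<le> p i \<and> 0 \<le> M * p i \<and> M * p i \<le> p i" if "i \<in> V" for i
    using p[OF that] M mult_right_mono[of M 1 "p i"] by (auto simp: a_def)
  ultimately show ?thesis
    unfolding transport_gap_def using dist_to_lipschitz[OF C]
    by (intro exI[of _ ?f] exI[of _ a] exI[of _ "\<lambda>i. M * p i"]) auto
qed

lemma transport_gap_mono: "transport_gap c \<Longrightarrow> c' \<le> c \<Longrightarrow> transport_gap c'"
  unfolding transport_gap_def by (meson order_trans)

lemma transport_gap_exists:
  assumes d2: "(\<Sum>i\<in>V. \<Sum>j\<in>V. p i * p j * d i j) = 2" and card: "2 \<le> card V"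
  shows "transport_gap ((1/5120)\<^sup>2 / 640 / sqrt (ln (real (card V))))"
proof -
  define L where "L = sqrt (ln (real (card V)))"
  have "(1::real)/4 \<le> ln 2" using ln_le_minus_one[of "1/2"] by (simp add: ln_div)
  also have "\<dots> \<le> ln (real (card V))" using card by simp
  finally have ln: "1/4 \<le> ln (real (card V))" .
  \<comment> \<open>This keeps \<open>\<Delta>\<close> below in the admissible range and the target
    gap below 3/8.\<close>
  then have L: "1/2 \<le> L" unfolding L_def by (intro real_le_rsqrt) (simp add: power2_eq_square)
  have L2: "L\<^sup>2 = ln (real (card V))" unfolding L_def using ln by simp
  show ?thesis
  proof (cases "\<exists>i\<in>V. 1/2 \<le> sum p (near (1/4) i)")
    case True
    then have "transport_gap (3/8)" using transport_gap_cluster d2 by blast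
    then show ?thesis
      by (rule transport_gap_mono) (use L in \<open>simp add: power2_eq_square field_simps flip: L_def\<close>)
  next
    case False
    \<comment> \<open>Chosen so that the condition on
      \<open>\<Delta>\<^sup>2 * ln (real (card V))\<close> holds with equality.\<close>
    define \<Delta> where "\<Delta> = (1/5120)\<^sup>2 / 4 / L"
    have "\<exists>A B. separated (1/160) \<Delta> A B"
    proof (rule separated_exists)
      show "sum p (near (1/4) i) \<le> 1/2" if "i \<in> V" for i using False that by force
      show "0 < \<Delta>" using L by (simp add: \<Delta>_def)
      show "\<Delta> \<le> (1/5120)\<^sup>2 / 2" using L by (simp add: \<Delta>_def field_simps)
      show "\<Delta>\<^sup>2 * ln (real (card V)) \<le> ((1/5120)\<^sup>2 / 4)\<^sup>2"
        using L unfolding L2[symmetric] \<Delta>_def by (simp add: power_divide)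
    qed
    then obtain A B where "separated (1/160) \<Delta> A B" by blast
    then have "transport_gap (1/160 * \<Delta>)" by (rule transport_gap_separated) simp
    then show ?thesis
      by (rule transport_gap_mono) (simp add: \<Delta>_def flip: L_def)
  qed
qed

end

subsection \<open>Circulations and the relaxation\<close>

context
  fixes n :: nat and E :: "(nat \<times> nat) set" and w :: "nat \<times> nat \<Rightarrow> real" and p :: "nat \<Rightarrow> real"
  assumes n: "2 \<le> n" and E: "E \<subseteq> vset n \<times> vset n"
    and w_pos: "\<And>e. e \<in> E \<Longrightarrow> 0 < w e" and p_pos: "\<And>i. i < n \<Longrightarrow> 0 < p i"
begin

lemma finite_E: "finite E"
  using E by (rule finite_subset) (simp add: vset_def)

lemma sum_out: "(\<Sum>e\<in>E. F e * y (fst e)) = (\<Sum>i<n. y i * (\<Sum>j\<in>{j. (i, j) \<in> E}. F (i, j)))"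
  for F :: "nat \<times> nat \<Rightarrow> real" and y :: "nat \<Rightarrow> real"
proof -
  have fin: "finite {j. (i, j) \<in> E}" for i
    by (rule finite_subset[of _ "{..<n}"]) (use E in \<open>auto simp: vset_def\<close>)
  have "(\<Sum>i<n. y i * (\<Sum>j\<in>{j. (i, j) \<in> E}. F (i, j))) =
      (\<Sum>i<n. \<Sum>j\<in>{j. (i, j) \<in> E}. F (i, j) * y i)"
    by (simp add: sum_distrib_left mult.commute)
  also have "\<dots> = (\<Sum>(i, j)\<in>(SIGMA i:{..<n}. {j. (i, j) \<in> E}). F (i, j) * y i)"
    using fin by (intro sum.Sigma) auto
  also have "(SIGMA i:{..<n}. {j. (i, j) \<in> E}) = E" using E by (auto simp: vset_def)
  finally show ?thesis by (simp add: case_prod_unfold)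
qed

lemma sum_in: "(\<Sum>e\<in>E. F e * y (snd e)) = (\<Sum>i<n. y i * (\<Sum>j\<in>{j. (j, i) \<in> E}. F (j, i)))"
  for F :: "nat \<times> nat \<Rightarrow> real" and y :: "nat \<Rightarrow> real"
proof -
  have fin: "finite {j. (j, i) \<in> E}" for i
    by (rule finite_subset[of _ "{..<n}"]) (use E in \<open>auto simp: vset_def\<close>)
  have "(\<Sum>i<n. y i * (\<Sum>j\<in>{j. (j, i) \<in> E}. F (j, i))) =
      (\<Sum>i<n. \<Sum>j\<in>{j. (j, i) \<in> E}. F (j, i) * y i)"
    by (simp add: sum_distrib_left mult.commute)
  also have "\<dots> = (\<Sum>(i, j)\<in>(SIGMA i:{..<n}. {j. (j, i) \<in> E}). F (j, i) * y i)"
    using fin by (intro sum.Sigma) auto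
  also have "\<dots> = (\<Sum>e\<in>E. F e * y (snd e))"
    by (rule sum.reindex_bij_witness[of _ prod.swap prod.swap])
       (use E in \<open>auto simp: vset_def\<close>)
  finally show ?thesis by simp
qed

text \<open>Conservation tested against all potentials, the form in which \<open>gale_flow\<close>
  supplies flows. The indicator of a vertex recovers conservation there.\<close>

lemma circulation_iff:
  "F \<in> circulations n E w \<longleftrightarrow> (\<forall>e\<in>E. 0 \<le> F e \<and> F e \<le> w e) \<and> (\<forall>e. e \<notin> E \<longrightarrow> F e = 0) \<and>
     (\<forall>y. (\<Sum>e\<in>E. F e * (y (fst e) - y (snd e))) = 0)"
proof -
  have eq: "(\<Sum>e\<in>E. F e * (y (fst e) - y (snd e))) =
     (\<Sum>i<n. y i * ((\<Sum>j\<in>{j. (i, j) \<in> E}. F (i, j)) - (\<Sum>j\<in>{j. (j, i) \<in> E}. F (j, i))))" for y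
    by (simp add: right_diff_distrib sum_subtractf sum_out sum_in)
  have "(\<forall>i\<in>vset n. (\<Sum>j\<in>{j. (i, j) \<in> E}. F (i, j)) = (\<Sum>j\<in>{j. (j, i) \<in> E}. F (j, i)))"
    if h: "\<And>y. (\<Sum>e\<in>E. F e * (y (fst e) - y (snd e))) = 0"
  proof
    fix i assume i: "i \<in> vset n"
    have "0 = (\<Sum>l<n. of_bool (l = i) *
       ((\<Sum>j\<in>{j. (l, j) \<in> E}. F (l, j)) - (\<Sum>j\<in>{j. (j, l) \<in> E}. F (j, l))))"
      using eq[of "\<lambda>l. of_bool (l = i)"] h[of "\<lambda>l. of_bool (l = i)"] by (simp only:)
    also have "\<dots> = (\<Sum>j\<in>{j. (i, j) \<in> E}. F (i, j)) - (\<Sum>j\<in>{j. (j, i) \<in> E}. F (j, i))"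
      using i by (subst sum.remove[of _ i]) (auto simp: vset_def)
    finally show "(\<Sum>j\<in>{j. (i, j) \<in> E}. F (i, j)) = (\<Sum>j\<in>{j. (j, i) \<in> E}. F (j, i))" by simp
  qed
  moreover have "(\<Sum>e\<in>E. F e * (y (fst e) - y (snd e))) = 0"
    if "\<forall>i\<in>vset n. (\<Sum>j\<in>{j. (i, j) \<in> E}. F (i, j)) = (\<Sum>j\<in>{j. (j, i) \<in> E}. F (j, i))" for y
    unfolding eq using that by (simp add: vset_def)
  ultimately show ?thesis unfolding circulations_def by blast
qed

lemma sqdist_commute: "sqdist n v i j = sqdist n v j i"
  by (simp add: sqdist_def power2_commute)

lemma sdp_objective_eq:
  assumes "\<And>e. e \<notin> E \<Longrightarrow> F e = 0"
  shows "sdp_objective n F v = (\<Sum>e\<in>E. F e * sqdist n v (fst e) (snd e)) / 2"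
proof -
  define h where "h e = F e * sqdist n v (fst e) (snd e)" for e
  define U where "U = {(i, j). i < j \<and> j < n}"
  have finU: "finite U" by (rule finite_subset[of _ "{..<n} \<times> {..<n}"]) (auto simp: U_def)
  have swap: "prod.swap ` U = {(i, j). j < i \<and> i < n}" by (force simp: U_def)
  \<comment> \<open>Extending from \<open>E\<close> to all pairs adds only zeros, and the diagonal
    drops out because \<open>sqdist\<close> vanishes on it.\<close>
  have "(\<Sum>e\<in>E. h e) = (\<Sum>e\<in>{..<n} \<times> {..<n}. h e)"
    using E assms by (intro sum.mono_neutral_left) (auto simp: vset_def h_def)
  also have "\<dots> = (\<Sum>e\<in>U \<union> prod.swap ` U. h e)"
    unfolding swap by (rule sum.mono_neutral_right) (auto simp: U_def h_def sqdist_def not_less_iff_gr_or_eq)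
  also have "\<dots> = sum h U + sum h (prod.swap ` U)"
    using finU by (intro sum.union_disjoint finite_imageI) (auto simp: U_def)
  also have "sum h (prod.swap ` U) = sum (h \<circ> prod.swap) U"
    by (rule sum.reindex) simp
  also have "sum h U + \<dots> = 2 * sdp_objective n F v"
    unfolding sdp_objective_def U_def[symmetric] sum_distrib_left sum.distrib[symmetric]
    by (intro sum.cong) (auto simp: h_def sqdist_commute algebra_simps)
  finally show ?thesis by (simp add: h_def)
qed

lemma cut_weight:
  assumes "S \<subseteq> vset n"
  shows "sum w (delta_out E S) = (\<Sum>e\<in>E. w e * of_bool (fst e \<in> S \<and> snd e \<notin> S))"
    and "sum w (delta_in n E S) = (\<Sum>e\<in>E. w e * of_bool (fst e \<notin> S \<and> snd e \<in> S))"
  unfolding delta_in_def delta_out_def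
  using finite_E E by (auto intro!: sum.mono_neutral_cong_left)

section \<open>Cuts and the expansion\<close>

definition mass :: real where "mass = sum p (vset n)"

lemma mass_pos: "0 < mass"
  unfolding mass_def using n p_pos by (intro sum_pos) (auto simp: vset_def lessThan_empty_iff)

lemma cut_mass: "S \<subseteq> vset n \<Longrightarrow> sum p (vset n - S) = mass - sum p S"
  by (simp add: mass_def sum_diff vset_def)

lemma cut_mass_pos: "S \<noteq> {} \<Longrightarrow> S \<subseteq> vset n \<Longrightarrow> 0 < sum p S"
  using p_pos finite_subset[of S "{..<n}"] by (intro sum_pos) (auto simp: vset_def)

lemma expansion_values: "finite {dir_expansion_set n E w p S | S. S \<noteq> {} \<and> S \<subset> vset n}"
  "{dir_expansion_set n E w p S | S. S \<noteq> {} \<and> S \<subset> vset n} \<noteq> {}"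
proof -
  have "{dir_expansion_set n E w p S | S. S \<noteq> {} \<and> S \<subset> vset n} \<subseteq>
      dir_expansion_set n E w p ` Pow (vset n)" by auto
  then show "finite {dir_expansion_set n E w p S | S. S \<noteq> {} \<and> S \<subset> vset n}"
    by (rule finite_subset) (simp add: vset_def)
  have "0 \<in> vset n" "1 \<in> vset n" using n by (simp_all add: vset_def)
  then have "{0} \<noteq> {} \<and> {0} \<subset> vset n" by (metis empty_not_insert insert_subset empty_subsetI psubsetI singletonD zero_neq_one)
  then show "{dir_expansion_set n E w p S | S. S \<noteq> {} \<and> S \<subset> vset n} \<noteq> {}" by blast
qed

lemma expansion_attained:
  obtains S where "S \<noteq> {}" "S \<subset> vset n" "dir_expansion n E w p = dir_expansion_set n E w p S"
  using Min_in[OF expansion_values] unfolding dir_expansion_def by auto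

text \<open>The expansion with its denominator cleared. The minimum is 0 for the empty and the full
  set, so the bound covers all \<open>S\<close>, as Gale's condition demands.\<close>

lemma expansion_cut:
  assumes S: "S \<subseteq> vset n"
  shows "dir_expansion n E w p * min (sum p S) (mass - sum p S) \<le>
     (\<Sum>e\<in>E. w e * of_bool (fst e \<in> S \<and> snd e \<notin> S))"
proof (cases "S = {} \<or> S = vset n")
  case True
  then have "min (sum p S) (mass - sum p S) = 0"
    using mass_pos by (auto simp: mass_def)
  then show ?thesis using w_pos by (auto intro!: sum_nonneg simp: less_imp_le)
next
  case False
  then have S': "S \<noteq> {}" "S \<subset> vset n" using S by auto
  define M where "M = min (sum p S) (mass - sum p S)"
  have "0 < sum p S" "0 < sum p (vset n - S)" using S' by (auto intro!: cut_mass_pos)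
  then have M: "0 < M" using cut_mass[OF S] by (simp add: M_def)
  have "dir_expansion n E w p \<le> dir_expansion_set n E w p S"
    unfolding dir_expansion_def using expansion_values(1) S' by (intro Min_le) auto
  also have "\<dots> = min (sum w (delta_out E S)) (sum w (delta_in n E S)) / M"
    by (simp add: dir_expansion_set_def cut_mass[OF S] M_def)
  also have "\<dots> \<le> sum w (delta_out E S) / M" using M by (intro divide_right_mono) auto
  finally show ?thesis using M by (simp add: cut_weight(1)[OF S] pos_le_divide_eq flip: M_def)
qed

lemma expansion_nonneg: "0 \<le> dir_expansion n E w p"
proof -
  obtain S where S: "S \<noteq> {}" "S \<subset> vset n" "dir_expansion n E w p = dir_expansion_set n E w p S"
    by (rule expansion_attained)
  have "0 \<le> sum w (delta_out E T)" for T
    by (intro sum_nonneg less_imp_le w_pos) (auto simp: delta_out_def)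
  moreover have "0 < sum p S" "0 < sum p (vset n - S)" using S by (auto intro!: cut_mass_pos)
  ultimately show ?thesis unfolding S(3) dir_expansion_set_def delta_in_def by simp
qed

section \<open>Bounds for the value of the relaxation\<close>

lemma zero_circulation: "(\<lambda>_. 0) \<in> circulations n E w"
  unfolding circulation_iff using w_pos by (auto simp: less_imp_le)

text \<open>Replacing \<open>F\<close> by \<open>w\<close> bounds every value, so that
  \<open>Sup\<close> is a true least upper bound.\<close>

lemma objective_bdd_above: "bdd_above {sdp_objective n F v | F. F \<in> circulations n E w}"
proof (rule bdd_aboveI)
  fix x assume "x \<in> {sdp_objective n F v | F. F \<in> circulations n E w}"
  then obtain F where F: "F \<in> circulations n E w" "x = sdp_objective n F v" by auto
  have "x = (\<Sum>e\<in>E. F e * sqdist n v (fst e) (snd e)) / 2"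
    unfolding F(2) by (rule sdp_objective_eq) (use F(1) in \<open>auto simp: circulation_iff\<close>)
  also have "\<dots> \<le> (\<Sum>e\<in>E. w e * sqdist n v (fst e) (snd e)) / 2"
    using F(1)
    by (intro divide_right_mono sum_mono mult_right_mono)
       (auto simp: circulation_iff sqdist_def intro!: sum_nonneg)
  finally show "x \<le> (\<Sum>e\<in>E. w e * sqdist n v (fst e) (snd e)) / 2" .
qed

lemma objective_le_Sup:
  "F \<in> circulations n E w \<Longrightarrow>
    sdp_objective n F v \<le> Sup {sdp_objective n F v | F. F \<in> circulations n E w}"
  using objective_bdd_above by (intro cSup_upper) auto

lemma Sup_nonneg: "0 \<le> Sup {sdp_objective n F v | F. F \<in> circulations n E w}"
  using objective_le_Sup[OF zero_circulation, of v] by (simp add: sdp_objective_def)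

lemma lambda_le:
  assumes "sdp_feasible n p v" "\<And>F. F \<in> circulations n E w \<Longrightarrow> sdp_objective n F v \<le> x"
  shows "lambda_tri n E w p \<le> x"
proof -
  have "lambda_tri n E w p \<le> Sup {sdp_objective n F v | F. F \<in> circulations n E w}"
    unfolding lambda_tri_def
  proof (rule cInf_lower)
    show "bdd_below {Sup {sdp_objective n F v |F. F \<in> circulations n E w} |v. sdp_feasible n p v}"
      by (rule bdd_belowI[of _ 0]) (use Sup_nonneg in auto)
  qed (use assms(1) in blast)
  also have "\<dots> \<le> x"
    using assms(2) zero_circulation by (intro cSup_least) auto
  finally show ?thesis .
qed

text \<open>One good circulation per feasible \<open>v\<close> suffices. \<open>v0\<close> makes the
  set under \<open>Inf\<close> nonempty.\<close>

lemma le_lambda: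
  assumes "sdp_feasible n p v0"
    and "\<And>v. sdp_feasible n p v \<Longrightarrow> \<exists>F\<in>circulations n E w. x \<le> sdp_objective n F v"
  shows "x \<le> lambda_tri n E w p"
  unfolding lambda_tri_def
proof (rule cInf_greatest)
  show "{Sup {sdp_objective n F v |F. F \<in> circulations n E w} |v. sdp_feasible n p v} \<noteq> {}"
    using assms(1) by auto
  fix y assume "y \<in> {Sup {sdp_objective n F v |F. F \<in> circulations n E w} |v. sdp_feasible n p v}"
  then obtain v where v: "sdp_feasible n p v"
    "y = Sup {sdp_objective n F v |F. F \<in> circulations n E w}" by auto
  obtain F where "F \<in> circulations n E w" "x \<le> sdp_objective n F v" using assms(2)[OF v(1)] by auto
  then show "x \<le> y" unfolding v(2) using objective_le_Sup order_trans by blast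
qed

section \<open>Cut vectors and the left inequality\<close>

text \<open>A one-dimensional solution placed in coordinate 0. The two values make the
  \<open>p\<close>-weighted sum 0, and the square root normalises the weighted sum of squares to
  1.\<close>

definition cut_vector :: "nat set \<Rightarrow> nat \<Rightarrow> nat \<Rightarrow> real" where
  "cut_vector S i k = (if k = 0 then (if i \<in> S then mass - sum p S else - sum p S) /
     sqrt (mass * sum p S * (mass - sum p S)) else 0)"

lemma sum_coordinate0: "(\<Sum>k<n. if k = 0 then x else 0) = x" for x :: real
  using n by (subst sum.remove[of _ 0]) auto

lemma sqdist_cut_vector:
  assumes S: "S \<noteq> {}" "S \<subset> vset n"
  shows "sqdist n (cut_vector S) i j =
    of_bool ((i \<in> S) \<noteq> (j \<in> S)) * mass / (sum p S * (mass - sum p S))"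
proof -
  have pos: "0 < sum p S" "0 < mass - sum p S"
    using S cut_mass_pos[of S] cut_mass_pos[of "vset n - S"] cut_mass[of S] by auto
  define D where "D = mass * sum p S * (mass - sum p S)"
  have D: "D > 0" using pos mass_pos by (simp add: D_def)
  have "sqdist n (cut_vector S) i j = (\<Sum>k<n. if k = 0 then
      (cut_vector S i 0 - cut_vector S j 0)\<^sup>2 else 0)"
    unfolding sqdist_def by (intro sum.cong) (auto simp: cut_vector_def)
  also have "\<dots> = (cut_vector S i 0 - cut_vector S j 0)\<^sup>2" by (rule sum_coordinate0)
  also have "\<dots> = of_bool ((i \<in> S) \<noteq> (j \<in> S)) * (mass\<^sup>2 / D)"
    using D unfolding cut_vector_def D_def[symmetric]
    by (auto simp: power_divide power2_eq_square diff_divide_distrib[symmetric] field_simps)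
  also have "mass\<^sup>2 / D = mass / (sum p S * (mass - sum p S))"
    using mass_pos by (simp add: D_def power2_eq_square)
  finally show ?thesis by simp
qed

lemma cut_vector_feasible:
  assumes S: "S \<noteq> {}" "S \<subset> vset n"
  shows "sdp_feasible n p (cut_vector S)"
proof -
  have pos: "0 < sum p S" "0 < mass - sum p S"
    using S cut_mass_pos[of S] cut_mass_pos[of "vset n - S"] cut_mass[of S] by auto
  define D where "D = mass * sum p S * (mass - sum p S)"
  have D: "D > 0" using pos mass_pos by (simp add: D_def)
  have split: "(\<Sum>i<n. p i * (if i \<in> S then x else y)) = sum p S * x + (mass - sum p S) * y"
    for x y :: real
  proof -
    have "(\<Sum>i<n. p i * (if i \<in> S then x else y)) =
        (\<Sum>i\<in>vset n - S. p i * y) + (\<Sum>i\<in>S. p i * x)"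
      using S by (subst sum.subset_diff[of S]) (auto simp: vset_def intro!: arg_cong2[of _ _ _ _ "(+)"] sum.cong)
    then show ?thesis using S cut_mass[of S] by (simp flip: sum_distrib_right)
  qed
  have "(\<Sum>i<n. p i * cut_vector S i k) = 0" for k
  proof (cases "k = 0")
    case True
    have "(\<Sum>i<n. p i * cut_vector S i k) =
        (\<Sum>i<n. p i * (if i \<in> S then (mass - sum p S) / sqrt D else - sum p S / sqrt D))"
      using True by (intro sum.cong) (auto simp: cut_vector_def D_def)
    then show ?thesis unfolding split by simp
  qed (simp add: cut_vector_def)
  moreover have "(\<Sum>i<n. p i * sqnorm n (cut_vector S) i) = 1"
  proof -
    have "sqnorm n (cut_vector S) i = (\<Sum>k<n. if k = 0 then (cut_vector S i 0)\<^sup>2 else 0)" for i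
      unfolding sqnorm_def by (intro sum.cong) (auto simp: cut_vector_def)
    then have "(\<Sum>i<n. p i * sqnorm n (cut_vector S) i) =
        (\<Sum>i<n. p i * (if i \<in> S then (mass - sum p S)\<^sup>2 / D else (sum p S)\<^sup>2 / D))"
      unfolding sum_coordinate0 using D
      by (intro sum.cong) (auto simp: cut_vector_def power_divide simp flip: D_def)
    also have "\<dots> = (sum p S * (mass - sum p S)\<^sup>2 + (mass - sum p S) * (sum p S)\<^sup>2) / D"
      unfolding split by (simp add: add_divide_distrib)
    also have "sum p S * (mass - sum p S)\<^sup>2 + (mass - sum p S) * (sum p S)\<^sup>2 = D"
      by (simp add: D_def power2_eq_square algebra_simps)
    finally show ?thesis using D by simp
  qed
  \<comment> \<open>The squared distance is a nonnegative multiple of the cut metric of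
    \<open>S\<close>.\<close>
  moreover have "sqdist n (cut_vector S) i j \<le> sqdist n (cut_vector S) i k + sqdist n (cut_vector S) k j"
    for i j k
    unfolding sqdist_cut_vector[OF S] add_divide_distrib[symmetric] distrib_right[symmetric]
    by (intro divide_right_mono mult_right_mono) (use pos mass_pos in auto)
  ultimately show ?thesis by (simp add: sdp_feasible_def)
qed

text \<open>A circulation sends as much flow out of \<open>S\<close> as into it, hence at most the
  smaller cut weight \<open>W\<close>. Only flow across the cut counts in the objective, each unit
  with the same squared distance \<open>R\<close>.\<close>

lemma lambda_le_expansion: "lambda_tri n E w p \<le> 2 * dir_expansion n E w p"
proof -
  obtain S where S: "S \<noteq> {}" "S \<subset> vset n" "dir_expansion n E w p = dir_expansion_set n E w p S"
    by (rule expansion_attained)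
  then have sub: "S \<subseteq> vset n" by auto
  have pos: "0 < sum p S" "0 < mass - sum p S"
    using S cut_mass_pos[of S] cut_mass_pos[of "vset n - S"] cut_mass[of S] by auto
  define R where "R = mass / (sum p S * (mass - sum p S))"
  define M where "M = min (sum p S) (mass - sum p S)"
  define W where "W = min (sum w (delta_out E S)) (sum w (delta_in n E S))"
  have M: "M > 0" using pos by (simp add: M_def)
  \<comment> \<open>The total mass is at most twice the heavier side; this is the factor 2 of the
    left inequality.\<close>
  have "mass * M \<le> 2 * (sum p S * (mass - sum p S))"
  proof -
    have "mass * M \<le> 2 * max (sum p S) (mass - sum p S) * M"
      using M by (intro mult_right_mono) (simp_all add: max_def)
    also have "\<dots> = 2 * (sum p S * (mass - sum p S))"
      by (simp add: M_def min_def max_def)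
    finally show ?thesis .
  qed
  then have R: "R \<le> 2 / M" using M pos by (simp add: R_def field_simps)
  have R0: "0 \<le> R" using pos mass_pos by (simp add: R_def)
  show ?thesis
  proof (rule lambda_le[OF cut_vector_feasible[OF S(1,2)]])
    fix F assume F: "F \<in> circulations n E w"
    then have Fw: "\<And>e. e \<in> E \<Longrightarrow> 0 \<le> F e \<and> F e \<le> w e" "\<And>e. e \<notin> E \<Longrightarrow> F e = 0"
      "\<And>y. (\<Sum>e\<in>E. F e * (y (fst e) - y (snd e))) = 0"
      unfolding circulation_iff by auto
    define out where "out = (\<Sum>e\<in>E. F e * of_bool (fst e \<in> S \<and> snd e \<notin> S))"
    define inn where "inn = (\<Sum>e\<in>E. F e * of_bool (fst e \<notin> S \<and> snd e \<in> S))"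
    have "out - inn = (\<Sum>e\<in>E. F e * (of_bool (fst e \<in> S) - of_bool (snd e \<in> S)))"
      unfolding out_def inn_def sum_subtractf[symmetric] by (intro sum.cong) auto
    also have "\<dots> = 0" using Fw(3)[of "\<lambda>i. of_bool (i \<in> S)"] .
    finally have eq: "inn = out" by simp
    have le: "out \<le> sum w (delta_out E S)" "inn \<le> sum w (delta_in n E S)"
      unfolding cut_weight[OF sub] out_def inn_def
      by (intro sum_mono mult_right_mono; use Fw(1) in auto)+
    have "sdp_objective n F (cut_vector S) =
        (\<Sum>e\<in>E. F e * (of_bool ((fst e \<in> S) \<noteq> (snd e \<in> S)) * R)) / 2"
      by (subst sdp_objective_eq[OF Fw(2)]) (simp_all add: sqdist_cut_vector[OF S(1,2)] R_def)
    also have "(\<Sum>e\<in>E. F e * (of_bool ((fst e \<in> S) \<noteq> (snd e \<in> S)) * R)) = (out + inn) * R"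
      unfolding out_def inn_def sum.distrib[symmetric] sum_distrib_right by (intro sum.cong) auto
    finally have "sdp_objective n F (cut_vector S) = out * R" by (simp add: eq)
    also have "\<dots> \<le> W * (2 / M)"
    proof (rule mult_mono)
      show "out \<le> W" using le eq by (simp add: W_def)
      show "0 \<le> W"
        unfolding W_def cut_weight[OF sub] using w_pos by (auto intro!: sum_nonneg simp: less_imp_le)
    qed (use R R0 in auto)
    also have "\<dots> = 2 * dir_expansion n E w p"
      by (simp add: S(3) dir_expansion_set_def cut_mass[OF sub] W_def M_def)
    finally show "sdp_objective n F (cut_vector S) \<le> 2 * dir_expansion n E w p" .
  qed
qed

section \<open>Transport flows and the right inequality\<close>

text \<open>Gale's condition holds because the net supply of \<open>S\<close> is at most the
  expansion times the lighter side: \<open>a \<le> p\<close> bounds it by \<open>S\<close>, and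
  \<open>b \<le> p\<close> with equal totals bounds it by the complement.\<close>

lemma transport_flow:
  assumes ab: "\<And>i. i < n \<Longrightarrow> 0 \<le> a i \<and> a i \<le> p i \<and> 0 \<le> b i \<and> b i \<le> p i"
    and "(\<Sum>i<n. a i) = (\<Sum>i<n. b i)"
  obtains F where "\<And>e. e \<in> E \<Longrightarrow> 0 \<le> F e \<and> F e \<le> w e" "\<And>e. e \<notin> E \<Longrightarrow> F e = 0"
    "\<And>y. (\<Sum>e\<in>E. F e * (y (fst e) - y (snd e))) =
       dir_expansion n E w p * (\<Sum>i<n. (a i - b i) * y i)"
proof -
  define \<phi> where "\<phi> = dir_expansion n E w p"
  have "\<exists>F. (\<forall>e\<in>E. 0 \<le> F e \<and> F e \<le> w e) \<and> (\<forall>e. e \<notin> E \<longrightarrow> F e = 0) \<and>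
     (\<forall>y::nat \<Rightarrow> real. (\<Sum>e\<in>E. F e * (y (fst e) - y (snd e))) =
       (\<Sum>i\<in>vset n. \<phi> * (a i - b i) * y i))"
  proof (rule gale_flow[OF finite_E _ E])
    show "(\<Sum>i\<in>vset n. \<phi> * (a i - b i)) = 0"
      using assms(2) by (simp add: sum_subtractf vset_def flip: sum_distrib_left)
    fix S assume S: "S \<subseteq> vset n"
    have "sum a S - sum b S \<le> sum p S"
    proof -
      have "sum a S \<le> sum p S" "0 \<le> sum b S"
        using S ab by (auto intro!: sum_mono sum_nonneg simp: vset_def)
      then show ?thesis by linarith
    qed
    moreover have "sum a S - sum b S \<le> mass - sum p S"
    proof -
      have "sum c (vset n - S) = (\<Sum>i<n. c i) - sum c S" for c :: "nat \<Rightarrow> real"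
        using S by (simp add: sum_diff vset_def)
      moreover have "sum b (vset n - S) \<le> sum p (vset n - S)" "0 \<le> sum a (vset n - S)"
        using ab by (auto intro!: sum_mono sum_nonneg simp: vset_def)
      ultimately show ?thesis using assms(2) cut_mass[OF S] by simp
    qed
    ultimately have "\<phi> * (sum a S - sum b S) \<le> \<phi> * min (sum p S) (mass - sum p S)"
      using expansion_nonneg by (intro mult_left_mono) (auto simp: \<phi>_def)
    also have "\<dots> \<le> (\<Sum>e\<in>E. w e * of_bool (fst e \<in> S \<and> snd e \<notin> S))"
      unfolding \<phi>_def by (rule expansion_cut[OF S])
    finally show "(\<Sum>i\<in>S. \<phi> * (a i - b i)) \<le>
        (\<Sum>e\<in>E. w e * of_bool (fst e \<in> S \<and> snd e \<notin> S))"
      by (simp add: sum_subtractf flip: sum_distrib_left)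
  qed (auto simp: vset_def w_pos less_imp_le)
  then obtain F where F: "\<forall>e\<in>E. 0 \<le> F e \<and> F e \<le> w e" "\<forall>e. e \<notin> E \<longrightarrow> F e = 0"
    "\<forall>y::nat \<Rightarrow> real. (\<Sum>e\<in>E. F e * (y (fst e) - y (snd e))) =
       (\<Sum>i\<in>vset n. \<phi> * (a i - b i) * y i)"
    by (elim exE conjE)
  show ?thesis
    by (rule that[of F]) (use F in \<open>auto simp: \<phi>_def vset_def sum_distrib_left mult.assoc\<close>)
qed

text \<open>\<open>F\<close> carries the scaled mass from \<open>a\<close> to \<open>b\<close>,
  \<open>G\<close> carries it back, and their average \<open>H\<close> is a circulation. Testing
  \<open>F\<close> against \<open>f\<close> yields the gap. The factor 1/4 combines the averaging
  with the 1/2 in the objective.\<close>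

lemma circulation_of_gap:
  assumes ab: "\<And>i. i < n \<Longrightarrow> 0 \<le> a i \<and> a i \<le> p i \<and> 0 \<le> b i \<and> b i \<le> p i"
    and sums: "(\<Sum>i<n. a i) = (\<Sum>i<n. b i)"
    and lip: "\<And>i j. i < n \<Longrightarrow> j < n \<Longrightarrow> f j - f i \<le> sqdist n v i j"
  shows "\<exists>F\<in>circulations n E w.
    dir_expansion n E w p * (\<Sum>i<n. (b i - a i) * f i) / 4 \<le> sdp_objective n F v"
proof -
  define \<phi> where "\<phi> = dir_expansion n E w p"
  obtain F where F: "\<And>e. e \<in> E \<Longrightarrow> 0 \<le> F e \<and> F e \<le> w e" "\<And>e. e \<notin> E \<Longrightarrow> F e = 0"
    "\<And>y. (\<Sum>e\<in>E. F e * (y (fst e) - y (snd e))) = \<phi> * (\<Sum>i<n. (a i - b i) * y i)"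
    using transport_flow[OF ab sums] unfolding \<phi>_def by blast
  have ba: "\<And>i. i < n \<Longrightarrow> 0 \<le> b i \<and> b i \<le> p i \<and> 0 \<le> a i \<and> a i \<le> p i" using ab by auto
  obtain G where G: "\<And>e. e \<in> E \<Longrightarrow> 0 \<le> G e \<and> G e \<le> w e" "\<And>e. e \<notin> E \<Longrightarrow> G e = 0"
    "\<And>y. (\<Sum>e\<in>E. G e * (y (fst e) - y (snd e))) = \<phi> * (\<Sum>i<n. (b i - a i) * y i)"
    using transport_flow[OF ba sums[symmetric]] unfolding \<phi>_def by blast
  define H where "H e = (F e + G e) / 2" for e
  have "(\<Sum>e\<in>E. H e * (y (fst e) - y (snd e))) = 0" for y
  proof -
    have "(\<Sum>e\<in>E. H e * (y (fst e) - y (snd e))) =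
        ((\<Sum>e\<in>E. F e * (y (fst e) - y (snd e))) + (\<Sum>e\<in>E. G e * (y (fst e) - y (snd e)))) / 2"
      unfolding H_def sum.distrib[symmetric] sum_divide_distrib
      by (intro sum.cong) (auto simp: field_simps)
    also have "\<dots> = \<phi> * ((\<Sum>i<n. (a i - b i) * y i) + (\<Sum>i<n. (b i - a i) * y i)) / 2"
      unfolding F(3) G(3) by (simp add: distrib_left)
    also have "(\<Sum>i<n. (a i - b i) * y i) + (\<Sum>i<n. (b i - a i) * y i) = 0"
      unfolding sum.distrib[symmetric] by (simp add: algebra_simps)
    finally show ?thesis by simp
  qed
  moreover have "0 \<le> H e \<and> H e \<le> w e" if "e \<in> E" for e
    using F(1)[OF that] G(1)[OF that] by (auto simp: H_def)
  moreover have H0: "H e = 0" if "e \<notin> E" for e using F(2) G(2) that by (simp add: H_def)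
  ultimately have H: "H \<in> circulations n E w" unfolding circulation_iff by blast
  have "\<phi> * (\<Sum>i<n. (b i - a i) * f i) / 4 = \<phi> * (\<Sum>i<n. (a i - b i) * - f i) / 4"
    by (simp add: algebra_simps)
  also have "\<dots> = (\<Sum>e\<in>E. F e * (f (snd e) - f (fst e))) / 4"
    unfolding F(3)[symmetric] by (simp add: algebra_simps)
  also have "\<dots> \<le> (\<Sum>e\<in>E. (F e + G e) * sqdist n v (fst e) (snd e)) / 4"
  proof (intro divide_right_mono sum_mono)
    fix e assume e: "e \<in> E"
    then have "fst e < n" "snd e < n" using E by (auto simp: vset_def)
    then have "F e * (f (snd e) - f (fst e)) \<le> F e * sqdist n v (fst e) (snd e)"
      using F(1)[OF e] lip by (intro mult_left_mono) auto
    also have "\<dots> \<le> (F e + G e) * sqdist n v (fst e) (snd e)"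
      using G(1)[OF e] by (intro mult_right_mono) (auto simp: sqdist_def sum_nonneg)
    finally show "F e * (f (snd e) - f (fst e)) \<le> (F e + G e) * sqdist n v (fst e) (snd e)" .
  qed simp
  also have "\<dots> = sdp_objective n H v"
    by (subst sdp_objective_eq[of H]) (simp_all add: F(2) G(2) H_def sum_divide_distrib)
  finally show ?thesis using H unfolding \<phi>_def by blast
qed

lemma feasible_objective:
  assumes v: "sdp_feasible n p v"
  shows "\<exists>F\<in>circulations n E w.
    dir_expansion n E w p * ((1/5120)\<^sup>2 / 2560 / sqrt (ln (real n))) \<le> sdp_objective n F v"
proof -
  \<comment> \<open>Rescaling to a probability \<open>q\<close>, with distances multiplied by
    \<open>mass\<close>, turns the normalisation of \<open>v\<close> into mean squared distance
    exactly 2.\<close>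
  define v' where "v' i k = sqrt mass * v i k" for i k
  define q where "q i = p i / mass" for i
  define d where "d i j = (\<Sum>k<n. (v' i k - v' j k)\<^sup>2)" for i j
  have d: "d i j = mass * sqdist n v i j" for i j
  proof -
    have "d i j = (\<Sum>k<n. mass * (v i k - v j k)\<^sup>2)"
      unfolding d_def v'_def right_diff_distrib[symmetric] power_mult_distrib
      using mass_pos by simp
    then show ?thesis by (simp add: sqdist_def sum_distrib_left)
  qed
  interpret l22_space "{..<n}" n v' q d
  proof
    fix i j k assume "i \<in> {..<n}" "j \<in> {..<n}" "k \<in> {..<n}"
    then have "sqdist n v i j \<le> sqdist n v i k + sqdist n v k j"
      using v by (auto simp: sdp_feasible_def)
    then show "d i j \<le> d i k + d k j"
      unfolding d using mass_pos by (simp flip: distrib_left)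
  next
    show "sum q {..<n} = 1"
      using mass_pos by (simp add: q_def mass_def vset_def flip: sum_divide_distrib)
  qed (use p_pos mass_pos in \<open>auto simp: d_def q_def less_imp_le\<close>)
  have "(\<Sum>i<n. \<Sum>j<n. p i * p j * sqdist n v i j) = 2 * mass"
  proof -
    have "(\<Sum>i<n. \<Sum>j<n. p i * p j * sqdist n v i j) =
      (\<Sum>i<n. \<Sum>j<n. p j * (p i * sqnorm n v i) + p i * (p j * sqnorm n v j) -
         2 * (\<Sum>k<n. (p i * v i k) * (p j * v j k)))"
    proof (intro sum.cong refl)
      fix i j
      have "sqdist n v i j = sqnorm n v i + sqnorm n v j - 2 * (\<Sum>k<n. v i k * v j k)"
        unfolding sqdist_def sqnorm_def
        by (simp add: power2_diff sum.distrib sum_subtractf sum_distrib_left mult.assoc)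
      moreover have "(\<Sum>k<n. (p i * v i k) * (p j * v j k)) = p i * p j * (\<Sum>k<n. v i k * v j k)"
        by (simp add: sum_distrib_left mult_ac)
      ultimately show "p i * p j * sqdist n v i j = p j * (p i * sqnorm n v i) +
          p i * (p j * sqnorm n v j) - 2 * (\<Sum>k<n. (p i * v i k) * (p j * v j k))"
        by (simp only:) (simp add: algebra_simps)
    qed
    also have "\<dots> = 2 * mass - 2 * (\<Sum>i<n. \<Sum>j<n. \<Sum>k<n. (p i * v i k) * (p j * v j k))"
      using v
      by (simp add: sum.distrib sum_subtractf sdp_feasible_def mass_def vset_def
          flip: sum_distrib_left sum_distrib_right)
    \<comment> \<open>The cross terms vanish because the weighted sum of the vectors is 0.\<close>
    also have "(\<Sum>i<n. \<Sum>j<n. \<Sum>k<n. (p i * v i k) * (p j * v j k)) = 0"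
    proof -
      have "(\<Sum>i<n. \<Sum>j<n. \<Sum>k<n. (p i * v i k) * (p j * v j k)) =
          (\<Sum>i<n. \<Sum>k<n. (p i * v i k) * (\<Sum>j<n. p j * v j k))"
        unfolding sum_distrib_left by (intro sum.cong refl sum.swap)
      also have "\<dots> = 0" using v by (intro sum.neutral) (auto simp: sdp_feasible_def)
      finally show ?thesis .
    qed
    finally show ?thesis by simp
  qed
  then have "(\<Sum>i<n. \<Sum>j<n. q i * q j * d i j) = 2"
  proof -
    assume h: "(\<Sum>i<n. \<Sum>j<n. p i * p j * sqdist n v i j) = 2 * mass"
    have "(\<Sum>i<n. \<Sum>j<n. q i * q j * d i j) = (\<Sum>i<n. \<Sum>j<n. p i * p j * sqdist n v i j / mass)"
      unfolding q_def d using mass_pos by (intro sum.cong refl) simp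
    also have "\<dots> = 2" using h mass_pos by (simp flip: sum_divide_distrib)
    finally show ?thesis .
  qed
  then have "transport_gap ((1/5120)\<^sup>2 / 640 / sqrt (ln (real (card {..<n}))))"
    by (rule transport_gap_exists) (use n in simp)
  then obtain f a b where fab': "\<forall>i\<in>{..<n}. 0 \<le> a i \<and> a i \<le> q i \<and> 0 \<le> b i \<and> b i \<le> q i"
    "(\<Sum>i<n. a i) = (\<Sum>i<n. b i)" "\<forall>i\<in>{..<n}. \<forall>j\<in>{..<n}. f j - f i \<le> d i j"
    "(1/5120)\<^sup>2 / 640 / sqrt (ln (real (card {..<n}))) \<le> (\<Sum>i<n. (b i - a i) * f i)"
    unfolding transport_gap_def by (elim exE conjE)
  then have fab: "\<And>i. i < n \<Longrightarrow> 0 \<le> a i \<and> a i \<le> q i \<and> 0 \<le> b i \<and> b i \<le> q i"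
    "(\<Sum>i<n. a i) = (\<Sum>i<n. b i)" "\<And>i j. i < n \<Longrightarrow> j < n \<Longrightarrow> f j - f i \<le> d i j"
    "(1/5120)\<^sup>2 / 640 / sqrt (ln (real n)) \<le> (\<Sum>i<n. (b i - a i) * f i)"
    by auto
  \<comment> \<open>Undoing the rescaling multiplies the masses by \<open>mass\<close> and divides
    \<open>f\<close> by it, so the gap is unchanged.\<close>
  have "\<exists>F\<in>circulations n E w.
    dir_expansion n E w p * (\<Sum>i<n. (mass * b i - mass * a i) * (f i / mass)) / 4 \<le> sdp_objective n F v"
  proof (rule circulation_of_gap)
    fix i assume "i < n"
    then show "0 \<le> mass * a i \<and> mass * a i \<le> p i \<and> 0 \<le> mass * b i \<and> mass * b i \<le> p i"
      using fab(1)[of i] mass_pos by (auto simp: q_def field_simps)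
  next
    show "(\<Sum>i<n. mass * a i) = (\<Sum>i<n. mass * b i)" using fab(2) by (simp flip: sum_distrib_left)
  next
    fix i j assume "i < n" "j < n"
    then show "f j / mass - f i / mass \<le> sqdist n v i j"
      using fab(3)[of i j] mass_pos by (simp add: d pos_divide_le_eq mult.commute flip: diff_divide_distrib)
  qed
  also have "(\<Sum>i<n. (mass * b i - mass * a i) * (f i / mass)) = (\<Sum>i<n. (b i - a i) * f i)"
    using mass_pos by (intro sum.cong) (auto simp: field_simps)
  finally obtain F where F: "F \<in> circulations n E w"
    "dir_expansion n E w p * (\<Sum>i<n. (b i - a i) * f i) / 4 \<le> sdp_objective n F v" by blast
  have "dir_expansion n E w p * ((1/5120)\<^sup>2 / 640 / sqrt (ln (real n))) \<le>
      dir_expansion n E w p * (\<Sum>i<n. (b i - a i) * f i)"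
    by (rule mult_left_mono[OF fab(4) expansion_nonneg])
  then show ?thesis using F by (intro bexI[of _ F]) auto
qed

lemma expansion_le_lambda:
  "dir_expansion n E w p \<le> (5120\<^sup>2 * 2560) * sqrt (ln (real n)) * lambda_tri n E w p"
proof -
  \<comment> \<open>Any proper cut will do: its cut vector witnesses that the relaxation is
    feasible.\<close>
  obtain S where S: "S \<noteq> {}" "S \<subset> vset n" by (rule expansion_attained)
  have "dir_expansion n E w p * ((1/5120)\<^sup>2 / 2560 / sqrt (ln (real n))) \<le> lambda_tri n E w p"
    by (rule le_lambda[OF cut_vector_feasible[OF S] feasible_objective])
  moreover have "0 < sqrt (ln (real n))" using n by simp
  ultimately show ?thesis by (simp add: field_simps)
qed

end

theorem mainTheorem1:
  shows "\<exists>c1 c2 :: real. c1 > 0 \<and> c2 > 0 \<and>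
    (\<forall>(n::nat) (E::(nat \<times> nat) set) (w::nat \<times> nat \<Rightarrow> real) (p::nat \<Rightarrow> real).
       n \<ge> 2 \<longrightarrow> E \<subseteq> vset n \<times> vset n \<longrightarrow>
       (\<forall>e\<in>E. w e > 0) \<longrightarrow> (\<forall>i\<in>vset n. p i > 0) \<longrightarrow>
       lambda_tri n E w p \<le> c1 * dir_expansion n E w p \<and>
       dir_expansion n E w p \<le> c2 * sqrt (ln (real n)) * lambda_tri n E w p)"
proof (rule exI[of _ 2], rule exI[of _ "5120\<^sup>2 * 2560"], intro conjI allI impI)
  fix n :: nat and E and w :: "nat \<times> nat \<Rightarrow> real" and p :: "nat \<Rightarrow> real"
  assume "n \<ge> 2" "E \<subseteq> vset n \<times> vset n" "\<forall>e\<in>E. w e > 0" "\<forall>i\<in>vset n. p i > 0"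
  then show "lambda_tri n E w p \<le> 2 * dir_expansion n E w p"
    "dir_expansion n E w p \<le> (5120\<^sup>2 * 2560) * sqrt (ln (real n)) * lambda_tri n E w p"
    using lambda_le_expansion[of n E w p] expansion_le_lambda[of n E w p] by (auto simp: vset_def)
qed auto

end
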